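(* Let $D$ be an oriented link diagram and let $\langle\alpha\rangle$ be the oriented enhanced traced state of a nontrivial state cycle $\alpha$ of $D$. Suppose $D'$ is obtained from $D$ by quasipositive modification compatible with $\langle\alpha\rangle$, and let $\Psi$ be the associated Jacobsson homomorphism from $Kh(D')$ to $Kh(D)$. Then there exists a state cycle $\widetilde{\alpha}$ of $D'$ such that $\Psi(\widetilde{\alpha})=\pm\alpha$. If $B$ is the quasipositive braid associated to this modification, then $\widetilde{\alpha}$ is the enhanced traced state of $D'$ in which: \begin{itemize} \item all crossings from $D$ are smoothed as in $\alpha$; \item negative crossings from $B$ are 1-smoothed and positive crossings from $B$ are 0-smoothed; \item every loop of $\widetilde{\alpha}$ is marked the same as in $\alpha$ (the loops of $\widetilde{\alpha}$ being the same as the loops of $\alpha$). \end{itemize}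
   Context: Khovanov complex (over $\mathbb{Q}$, Bar-Natan's conventions). Let $D$ be a diagram of an oriented link with an ordering of its crossings. Each crossing has a 0-smoothing and a 1-smoothing (standard convention; the orientation-consistent smoothing is the 0-smoothing at a positive crossing and the 1-smoothing at a negative crossing). A state $\sigma$ is a choice of smoothing at every crossing; it yields a collection of planar loops. Let $V=\langle v_+,v_-\rangle_{\mathbb{Q}}$. An enhanced state (ET state) based on $\sigma$ is a marking of each loop of $\sigma$ by $v_+$ or $v_-$, i.e. a basis element of $V^{\otimes k}$, $k$ the number of loops; the enhanced states form a basis of the chain complex. The differential is $d=\sum_e(-1)^{|e|}d_e$, where for a state $\sigma$ the edges $e$ leaving $\sigma$ correspond to changing one 0-smoothing of $\sigma$ to a 1-smoothing, $|e|$ is the number of 1-smoothed crossings preceding the changed crossing, and $d_e$ is the identity on unaffected loops and on the affected loops is: (two loops merge) $v_+\otimes v_+\mapsto v_+$, $v_+\otimes v_-\mapsto v_-$, $v_-\otimes v_+\mapsto v_-$, $v_-\otimes v_-\mapsto 0$; (one loop splits) $v_+\mapsto v_+\otimes v_-+v_-\otimes v_+$, $v_-\mapsto v_-\otimes v_-$. An enhanced state $\alpha$ is a state cycle if $d(\alpha)=0$, and is nontrivial if $[\alpha]\neq0$ in $Kh(D)$. Each crossing leaves a trace in a state: an arc joining the two strands of its smoothing; enhanced traced states (ET states) are enhanced states with these traces recorded. Oriented states. An oriented enhanced traced (OET) state of $D$ is an ET state in which every arc between traces is also marked with the orientation of that arc in the diagram $D$; $\langle\alpha\rangle$ denotes the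 OET state of the ET state $\alpha$. For $\langle\alpha\rangle$ representing a nontrivial homology class, a collection $A$ of oriented arcs of $\langle\alpha\rangle$ is braid-parallel with respect to $\langle\alpha\rangle$ if (1) the arcs come from pairwise distinct loops; (2) each arc is marked by $v_-$; (3) the arcs can be joined by a line transverse to each of them which touches only the arcs of $A$ and meets each arc in the same orientation. Quasipositive modification. A braid is quasipositive if in the braid group generators $\tau_i$ it can be written as $\prod_k\omega_k\tau_{i_k}\omega_k^{-1}$ with $\omega_k$ braid words and $\tau_{i_k}$ positive crossings; the $\tau_{i_k}$ are the central positive crossings. $D'$ is a quasipositive modification of $D$ compatible with $\langle\alpha\rangle$ if there is a collection of arcs of $D$ that is braid-parallel with respect to $\langle\alpha\rangle$ and a quasipositive braid $B$ on as many strands (given by such a word) such that replacing the arcs (viewed as a trivial braid in a box around the transverse line, with matching orientations) by $B$ yields $D'$. Jacobsson homomorphisms. An orientable link cobordism $\Sigma$ from $L_1$ to $L_2$ induces (Jacobsson) a homomorphism $\Psi_\Sigma:Kh^{i,j}(L_1)\to Kh^{i,j+\chi(\Sigma)}(L_2)$, well defined up to overall sign, constructed from explicit chain maps for Morse and Reidemeister moves. The Jacobsson homomorphism associated to a quasipositive modification is the one induced by the cobordism from $D'$ to $D$ that 0-resolves each central positive crossing of $B$ (for each, a saddle/1-handle followed by undoing a positive Reidemeister I twist) and then cancels the remaining conjugating words $\omega_k\omega_k^{-1}$ by Reidemeister II moves. *)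

theory Defs
  imports Complex_Main
begin

section \<open>Oriented link diagrams\<close>

text \<open>
  A diagram is given in sliced form: it is cut by horizontal lines into elementary layers, listed
  from bottom to top, and the strands meeting a horizontal line are numbered from the left,
  starting with 0.  Every planar link diagram has this form up to planar isotopy; split diagrams,
  nested components and components without crossings are included.

  \<^item> \<open>Cup i u\<close> is a local minimum whose two ends become the strands \<open>i\<close> and \<open>i + 1\<close>; its left end
    is oriented upwards iff \<open>u\<close>.
  \<^item> \<open>Cap i\<close> is a local maximum joining the strands \<open>i\<close> and \<open>i + 1\<close>.
  \<^item> \<open>Cross c t i\<close> is a crossing of the strands \<open>i\<close> and \<open>i + 1\<close>.  The label \<open>c\<close> is the name of the
    crossing; the crossings of a diagram are ordered by their labels, so all orderings occur.
    For \<open>t = Tau\<close> the strand from bottom left to top right is the overstrand, for \<open>t = TauInv\<close> it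
    is the understrand.  If both strands point upwards, or both downwards, then \<open>Tau\<close> is a
    positive and \<open>TauInv\<close> a negative crossing.
\<close>

datatype twist = Tau | TauInv

datatype layer = Cup nat bool | Cap nat | Cross nat twist nat

type_synonym diagram = "layer list"

text \<open>The orientations (true: upwards) of the strands above a layer, given those below it.\<close>

fun step :: "layer \<Rightarrow> bool list \<Rightarrow> bool list" where
  "step (Cup i u) l = take i l @ [u, \<not> u] @ drop i l"
| "step (Cap i) l = take i l @ drop (i + 2) l"
| "step (Cross c t i) l = l[i := l ! (i + 1), i + 1 := l ! i]"

fun fits :: "layer \<Rightarrow> bool list \<Rightarrow> bool" where
  "fits (Cup i u) l \<longleftrightarrow> i \<le> length l"
| "fits (Cap i) l \<longleftrightarrow> i + 1 < length l \<and> l ! i \<noteq> l ! (i + 1)"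
| "fits (Cross c t i) l \<longleftrightarrow> i + 1 < length l"

definition level :: "diagram \<Rightarrow> nat \<Rightarrow> bool list" where
  "level D k = fold step (take k D) []"

definition width :: "diagram \<Rightarrow> nat \<Rightarrow> nat" where
  "width D k = length (level D k)"

definition crossing_labels :: "diagram \<Rightarrow> nat list" where
  "crossing_labels D = concat (map (\<lambda>x. case x of Cross c t i \<Rightarrow> [c] | _ \<Rightarrow> []) D)"

definition crossings :: "diagram \<Rightarrow> nat set" where
  "crossings D = set (crossing_labels D)"

definition link_diagram :: "diagram \<Rightarrow> bool" where
  "link_diagram D \<longleftrightarrow>
     (\<forall>k<length D. fits (D ! k) (level D k)) \<and> level D (length D) = [] \<and>
     distinct (crossing_labels D)"

section \<open>States and enhanced states\<close>

text \<open>
  The point \<open>(k, j)\<close> is the intersection of strand \<open>j\<close> with the horizontal line below layer \<open>k\<close>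
  (above the last layer for \<open>k = length D\<close>).  A state is the set \<open>S\<close> of its 1-smoothed crossings.
\<close>

type_synonym point = "nat \<times> nat"

definition points :: "diagram \<Rightarrow> point set" where
  "points D = {(k, j). k \<le> length D \<and> j < width D k}"

text \<open>
  Independently of orientations, the 0-smoothing of \<open>Tau\<close> and the 1-smoothing of \<open>TauInv\<close> are
  vertical (two vertical strands); the other two smoothings are horizontal (a cap below a cup).
\<close>

definition vertical :: "nat set \<Rightarrow> nat \<Rightarrow> twist \<Rightarrow> bool" where
  "vertical S c t \<longleftrightarrow> (c \<in> S) = (t = TauInv)"

text \<open>
  The pieces of arc of the smoothed layer \<open>k\<close>, as pairs of end points; \<open>w\<close> is the number of
  strands below the layer.
\<close>

fun links :: "nat set \<Rightarrow> nat \<Rightarrow> nat \<Rightarrow> layer \<Rightarrow> (point \<times> point) set" where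
  "links S k w (Cup i u) =
     insert ((k + 1, i), (k + 1, i + 1))
       {((k, j), (k + 1, if j < i then j else j + 2)) |j. j < w}"
| "links S k w (Cap i) =
     insert ((k, i), (k, i + 1))
       {((k, if j < i then j else j + 2), (k + 1, j)) |j. j + 2 < w}"
| "links S k w (Cross c t i) =
     (if vertical S c t then {((k, j), (k + 1, j)) |j. j < w}
      else {((k, i), (k, i + 1)), ((k + 1, i), (k + 1, i + 1))} \<union>
           {((k, j), (k + 1, j)) |j. j < w \<and> j \<noteq> i \<and> j \<noteq> i + 1})"

definition connected_in :: "diagram \<Rightarrow> nat set \<Rightarrow> (point \<times> point) set" where
  "connected_in D S =
     (let R = (\<Union>k<length D. links S k (width D k) (D ! k)) in (R \<union> R\<inverse>)\<^sup>*)"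

definition loop_of :: "diagram \<Rightarrow> nat set \<Rightarrow> point \<Rightarrow> point set" where
  "loop_of D S x = connected_in D S `` {x}"

definition loops :: "diagram \<Rightarrow> nat set \<Rightarrow> point set set" where
  "loops D S = loop_of D S ` points D"

datatype mark = Plus | Minus

type_synonym 'p marking = "'p set \<rightharpoonup> mark"

text \<open>
  An enhanced state is a state together with a marking of its loops by \<open>v\<^sub>+\<close> (\<open>Plus\<close>) or
  \<open>v\<^sub>-\<close> (\<open>Minus\<close>).  The traces are determined by \<open>D\<close> and \<open>S\<close> and need not be recorded.
\<close>

type_synonym estate = "nat set \<times> point marking"

definition estates :: "diagram \<Rightarrow> estate set" where
  "estates D = {(S, m). S \<subseteq> crossings D \<and> dom m = loops D S}"

section \<open>The Khovanov complex\<close>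

fun mult :: "mark \<Rightarrow> mark \<Rightarrow> mark option" where
  "mult Plus y = Some y"
| "mult x Plus = Some x"
| "mult Minus Minus = None"

fun comult :: "mark \<Rightarrow> (mark \<times> mark) set" where
  "comult Plus = {(Plus, Minus), (Minus, Plus)}"
| "comult Minus = {(Minus, Minus)}"

text \<open>
  Two marked families of loops, before and after a saddle.  The loops are sets of points of one
  and the same set; the unaffected ones are those which belong to both families.
\<close>

definition merges :: "'p marking \<Rightarrow> 'p marking \<Rightarrow> bool" where
  "merges m m' \<longleftrightarrow>
     (\<exists>A B. A \<in> dom m \<and> B \<in> dom m \<and> A \<noteq> B \<and>
        dom m' = insert (A \<union> B) (dom m - {A, B}) \<and>
        (\<forall>K \<in> dom m - {A, B}. m' K = m K) \<and>
        m' (A \<union> B) = mult (the (m A)) (the (m B)))"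

definition splits :: "'p marking \<Rightarrow> 'p marking \<Rightarrow> bool" where
  "splits m m' \<longleftrightarrow>
     (\<exists>A B. A \<in> dom m' \<and> B \<in> dom m' \<and> A \<noteq> B \<and>
        dom m = insert (A \<union> B) (dom m' - {A, B}) \<and>
        (\<forall>K \<in> dom m' - {A, B}. m' K = m K) \<and>
        (the (m' A), the (m' B)) \<in> comult (the (m (A \<union> B))))"

definition saddle_coeff :: "'p marking \<Rightarrow> 'p marking \<Rightarrow> rat" where
  "saddle_coeff m m' = of_bool (merges m m' \<or> splits m m')"

text \<open>
  Chains are functions on enhanced states which vanish off \<open>estates D\<close> (a finite set); linear maps
  are given by their matrices.
\<close>

type_synonym chain = "estate \<Rightarrow> rat"

definition ket :: "estate \<Rightarrow> chain" where
  "ket \<alpha> = (\<lambda>\<beta>. of_bool (\<beta> = \<alpha>))"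

definition scale :: "rat \<Rightarrow> chain \<Rightarrow> chain" where
  "scale r x = (\<lambda>\<beta>. r * x \<beta>)"

definition chains :: "diagram \<Rightarrow> chain set" where
  "chains D = {x. \<forall>\<beta>. \<beta> \<notin> estates D \<longrightarrow> x \<beta> = 0}"

definition lin :: "diagram \<Rightarrow> diagram \<Rightarrow> (estate \<Rightarrow> estate \<Rightarrow> rat) \<Rightarrow> chain \<Rightarrow> chain" where
  "lin D E a x = (\<lambda>\<beta>. if \<beta> \<in> estates E then \<Sum>\<alpha> \<in> estates D. x \<alpha> * a \<alpha> \<beta> else 0)"

fun diff_coeff :: "diagram \<Rightarrow> estate \<Rightarrow> estate \<Rightarrow> rat" where
  "diff_coeff D (S, m) (S', m') =
     (\<Sum>c \<in> crossings D - S. of_bool (S' = insert c S) * (-1) ^ card {x \<in> S. x < c} *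
        saddle_coeff m m')"

definition diff :: "diagram \<Rightarrow> chain \<Rightarrow> chain" where
  "diff D = lin D D (diff_coeff D)"

definition cycles :: "diagram \<Rightarrow> chain set" where
  "cycles D = {x \<in> chains D. diff D x = (\<lambda>_. 0)}"

definition boundaries :: "diagram \<Rightarrow> chain set" where
  "boundaries D = diff D ` chains D"

definition hclass :: "diagram \<Rightarrow> chain \<Rightarrow> chain set" where
  "hclass D z = {\<lambda>\<beta>. z \<beta> + w \<beta> |w. w \<in> boundaries D}"

definition Kh :: "diagram \<Rightarrow> chain set set" where
  "Kh D = hclass D ` cycles D"

definition state_cycle :: "diagram \<Rightarrow> estate \<Rightarrow> bool" where
  "state_cycle D \<alpha> \<longleftrightarrow> \<alpha> \<in> estates D \<and> diff D (ket \<alpha>) = (\<lambda>_. 0)"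

definition nontrivial :: "diagram \<Rightarrow> estate \<Rightarrow> bool" where
  "nontrivial D \<alpha> \<longleftrightarrow> hclass D (ket \<alpha>) \<noteq> hclass D (\<lambda>_. 0)"

section \<open>Quasipositive modification\<close>

text \<open>
  The transverse line is drawn as the segment of the horizontal line at height \<open>k\<close> which meets
  exactly the strands \<open>p, \<dots>, p + n - 1\<close>; a planar isotopy brings every diagram with a transverse
  line into this position.  The orientation of the arcs in the oriented state \<open>\<langle>(S, m)\<rangle>\<close> is the
  orientation \<open>level D k\<close> of the diagram.
\<close>

definition braid_parallel :: "diagram \<Rightarrow> estate \<Rightarrow> nat \<Rightarrow> nat \<Rightarrow> nat \<Rightarrow> bool" where
  "braid_parallel D \<alpha> k p n \<longleftrightarrow>
     state_cycle D \<alpha> \<and> nontrivial D \<alpha> \<and>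
     k \<le> length D \<and> p + n \<le> width D k \<and>
     inj_on (\<lambda>j. loop_of D (fst \<alpha>) (k, j)) {p..<p + n} \<and>
     (\<forall>j \<in> {p..<p + n}. snd \<alpha> (loop_of D (fst \<alpha>) (k, j)) = Some Minus) \<and>
     (\<forall>i \<in> {p..<p + n}. \<forall>j \<in> {p..<p + n}. level D k ! i = level D k ! j)"

text \<open>
  A letter \<open>(c, t, i)\<close> of a braid word is the generator \<open>\<tau>\<^sub>i\<close> (\<open>t = Tau\<close>) or its inverse, realised
  by a crossing with label \<open>c\<close>; generators are numbered from 0.  The block \<open>(u, g, v)\<close> is the word
  \<open>u g v\<close>.  In a quasipositive braid word \<open>v\<close> spells the inverse of \<open>u\<close> and \<open>g\<close> is a central
  positive crossing; \<open>None\<close> takes the place of a central crossing which has been resolved.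
\<close>

type_synonym letter = "nat \<times> twist \<times> nat"

type_synonym block = "letter list \<times> letter option \<times> letter list"

fun inv_twist :: "twist \<Rightarrow> twist" where
  "inv_twist Tau = TauInv"
| "inv_twist TauInv = Tau"

fun block_word :: "block \<Rightarrow> letter list" where
  "block_word (u, g, v) = u @ (case g of None \<Rightarrow> [] | Some x \<Rightarrow> [x]) @ v"

definition braid_word :: "block list \<Rightarrow> letter list" where
  "braid_word bs = concat (map block_word bs)"

definition quasipositive :: "nat \<Rightarrow> block list \<Rightarrow> bool" where
  "quasipositive n bs \<longleftrightarrow>
     (\<forall>(c, t, i) \<in> set (braid_word bs). i + 1 < n) \<and>
     (\<forall>(u, g, v) \<in> set bs.
        (\<exists>c i. g = Some (c, Tau, i)) \<and>
        map snd v = rev (map (\<lambda>(c, t, i). (inv_twist t, i)) u))"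

text \<open>The braid as a tangle whose leftmost strand is strand \<open>p\<close>.\<close>

definition tangle :: "nat \<Rightarrow> letter list \<Rightarrow> layer list" where
  "tangle p ls = map (\<lambda>(c, t, i). Cross c t (p + i)) ls"

text \<open>
  The strands of the braid point all upwards or all downwards, according to the arcs they replace.
  The word is inserted from bottom to top in both cases: turning a braid upside down reverses the
  word and mirrors the indices of its generators, and this preserves the form of quasipositive
  words.
\<close>

definition quasipositive_modification ::
    "diagram \<Rightarrow> estate \<Rightarrow> diagram \<Rightarrow> nat \<Rightarrow> nat \<Rightarrow> nat \<Rightarrow> block list \<Rightarrow> bool" where
  "quasipositive_modification D \<alpha> D' k p n bs \<longleftrightarrow>
     braid_parallel D \<alpha> k p n \<and> quasipositive n bs \<and>
     D' = take k D @ tangle p (braid_word bs) @ drop k D \<and>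
     distinct (crossing_labels D')"

section \<open>Chain maps of elementary cobordisms\<close>

text \<open>
  An elementary cobordism replaces the diagram \<open>U @ P @ W\<close> by \<open>U @ Q @ W\<close>.  A loop is compared
  across the move by means of the part of it which lies outside of the layers that are replaced:
  \<open>Inl\<close> tags the points below, \<open>Inr\<close> those above, where heights are counted from the top of the
  box.  Both parts contain the boundary of the box.
\<close>

definition trace :: "nat \<Rightarrow> nat \<Rightarrow> point set \<Rightarrow> (point + point) set" where
  "trace a b K = Inl ` {x \<in> K. fst x \<le> a} \<union>
     (\<lambda>(k, j). Inr (k - (a + b), j)) ` {x \<in> K. a + b \<le> fst x}"

text \<open>The marking of the loops which are not contained in the interior of the box.\<close>

definition outer :: "nat \<Rightarrow> nat \<Rightarrow> point marking \<Rightarrow> (point + point) marking" where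
  "outer a b m = (\<lambda>T. if T \<noteq> {} \<and> (\<exists>K \<in> dom m. trace a b K = T)
     then m (THE K. K \<in> dom m \<and> trace a b K = T) else None)"

text \<open>The counit (\<open>v\<^sub>-\<close> to 1 and \<open>v\<^sub>+\<close> to 0) on all loops inside the box.\<close>

definition death :: "nat \<Rightarrow> nat \<Rightarrow> point marking \<Rightarrow> bool" where
  "death a b m \<longleftrightarrow> (\<forall>K \<in> dom m. trace a b K = {} \<longrightarrow> m K = Some Minus)"

definition isotopy_map ::
    "layer list \<Rightarrow> layer list \<Rightarrow> layer list \<Rightarrow> layer list \<Rightarrow> chain \<Rightarrow> chain" where
  "isotopy_map U P Q W = lin (U @ P @ W) (U @ Q @ W) (\<lambda>(S, m) (S', m').
     of_bool (S' = S \<and> outer (length U) (length Q) m' = outer (length U) (length P) m))"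

definition saddle_map ::
    "layer list \<Rightarrow> layer list \<Rightarrow> layer list \<Rightarrow> layer list \<Rightarrow> chain \<Rightarrow> chain" where
  "saddle_map U P Q W = lin (U @ P @ W) (U @ Q @ W) (\<lambda>(S, m) (S', m').
     of_bool (S' = S) *
     saddle_coeff (outer (length U) (length P) m) (outer (length U) (length Q) m'))"

text \<open>
  Removal of a positive Reidemeister I twist \<open>P\<close> with crossing \<open>c\<close>.  The 0-smoothing of \<open>c\<close> splits
  off a small circle, to which the counit is applied; the 1-smoothing is sent to 0.
\<close>

definition RI_map :: "layer list \<Rightarrow> layer list \<Rightarrow> nat \<Rightarrow> layer list \<Rightarrow> chain \<Rightarrow> chain" where
  "RI_map U P c W = lin (U @ P @ W) (U @ W) (\<lambda>(S, m) (S', m').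
     of_bool (c \<notin> S \<and> S' = S \<and> death (length U) (length P) m \<and>
              outer (length U) 0 m' = outer (length U) (length P) m))"

text \<open>
  Removal of the two crossings of a Reidemeister II move; \<open>a\<close> is the label of the \<open>Tau\<close>, \<open>b\<close> that
  of the \<open>TauInv\<close>.  The states with exactly \<open>b\<close> 1-smoothed have vertical strands and are mapped
  identically; on the states with exactly \<open>a\<close> 1-smoothed, which have a circle between a cap and a
  cup, the map is minus the counit on the circle followed by the saddle from cap and cup to vertical
  strands; all remaining states are sent to 0.  The additional sign counts the 1-smoothed crossings
  after the 1-smoothed one of \<open>a\<close>, \<open>b\<close>: it accounts for the removal of that crossing from the
  ordering.
\<close>

definition RII_map ::
    "layer list \<Rightarrow> layer list \<Rightarrow> nat \<Rightarrow> nat \<Rightarrow> layer list \<Rightarrow> chain \<Rightarrow> chain" where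
  "RII_map U P a b W = lin (U @ P @ W) (U @ W) (\<lambda>(S, m) (S', m').
     if a \<notin> S \<and> b \<in> S \<and> S' = S - {b} then
       (-1) ^ card {x \<in> S. b < x} *
       of_bool (outer (length U) 0 m' = outer (length U) (length P) m)
     else if a \<in> S \<and> b \<notin> S \<and> S' = S - {a} then
       - ((-1) ^ card {x \<in> S. a < x}) * of_bool (death (length U) (length P) m) *
       saddle_coeff (outer (length U) (length P) m) (outer (length U) 0 m')
     else 0)"

text \<open>
  Resolving a central positive crossing \<open>c\<close> of the strands \<open>i\<close>, \<open>i + 1\<close>, both with orientation \<open>u\<close>.
  First strand \<open>i\<close> is bent by a planar isotopy so that its parts before and after the crossing
  are neighbours, as a cap below a cup; then the saddle there makes strand \<open>i\<close> vertical and leaves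
  a positive twist in strand \<open>i + 1\<close>, which is finally removed.
\<close>

definition resolve_map ::
    "layer list \<Rightarrow> nat \<Rightarrow> nat \<Rightarrow> bool \<Rightarrow> layer list \<Rightarrow> chain \<Rightarrow> chain" where
  "resolve_map U c i u W =
     (let A = [Cup (i + 1) (\<not> u)];
          M = [Cap i, Cup i u];
          Z = [Cross c Tau (i + 2), Cap (i + 1)]
      in RI_map U (A @ Z) c W \<circ> saddle_map (U @ A) M [] (Z @ W) \<circ>
         isotopy_map U [Cross c Tau i] (A @ M @ Z) W)"

definition cancel_map ::
    "layer list \<Rightarrow> letter \<Rightarrow> letter \<Rightarrow> nat \<Rightarrow> layer list \<Rightarrow> chain \<Rightarrow> chain" where
  "cancel_map U x y p W =
     (let P = tangle p [x, y]
      in if fst (snd x) = Tau then RII_map U P (fst x) (fst y) W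
         else RII_map U P (fst y) (fst x) W)"

section \<open>The Jacobsson homomorphism of a quasipositive modification\<close>

text \<open>
  \<open>jacobsson_chain_map X p u Y bs f\<close>: \<open>f\<close> is the composition of the chain maps of a movie from the
  diagram in which \<open>bs\<close> is inserted between \<open>X\<close> and \<open>Y\<close> to the diagram \<open>X @ Y\<close>.  The movie first
  resolves all central crossings, in any order, and then cancels in each block the last letter of
  \<open>\<omega>\<close> against the first letter of its inverse, with any order among the blocks.
\<close>

inductive jacobsson_chain_map ::
    "layer list \<Rightarrow> nat \<Rightarrow> bool \<Rightarrow> layer list \<Rightarrow> block list \<Rightarrow> (chain \<Rightarrow> chain) \<Rightarrow> bool"
  for X :: "layer list" and p :: nat and u :: bool and Y :: "layer list" where
  finished: "\<forall>b \<in> set bs. b = ([], None, []) \<Longrightarrow> jacobsson_chain_map X p u Y bs id"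
| resolve: "jacobsson_chain_map X p u Y (bs @ (w, None, w') # bs') f \<Longrightarrow>
    jacobsson_chain_map X p u Y (bs @ (w, Some (c, Tau, i), w') # bs')
      (f \<circ> resolve_map (X @ tangle p (braid_word bs @ w)) c (p + i) u
             (tangle p (w' @ braid_word bs') @ Y))"
| cancel: "jacobsson_chain_map X p u Y (bs @ (w, None, w') # bs') f \<Longrightarrow>
    \<forall>(v, g, v') \<in> set (bs @ bs'). g = None \<Longrightarrow>
    snd y = (inv_twist (fst (snd x)), snd (snd x)) \<Longrightarrow>
    jacobsson_chain_map X p u Y (bs @ (w @ [x], None, y # w') # bs')
      (f \<circ> cancel_map (X @ tangle p (braid_word bs @ w)) x y p
             (tangle p (w' @ braid_word bs') @ Y))"

text \<open>
  \<open>\<Psi> : Kh D' \<rightarrow> Kh D\<close> is the map induced by \<open>f\<close> on homology, up to an overall sign.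
\<close>

definition induced_on_homology ::
    "diagram \<Rightarrow> diagram \<Rightarrow> (chain \<Rightarrow> chain) \<Rightarrow> (chain set \<Rightarrow> chain set) \<Rightarrow> bool" where
  "induced_on_homology D' D f \<Psi> \<longleftrightarrow>
     \<Psi> ` Kh D' \<subseteq> Kh D \<and>
     (\<exists>s \<in> {1, -1}. \<forall>z \<in> cycles D'. \<Psi> (hclass D' z) = hclass D (scale s (f z)))"

text \<open>
  The diagram \<open>D'\<close> is obtained from \<open>D\<close> by inserting \<open>b\<close> layers at height \<open>k\<close>.  This map from the
  points of \<open>D'\<close> to those of \<open>D\<close> shrinks the inserted layers vertically to a line.
\<close>

definition collapse :: "nat \<Rightarrow> nat \<Rightarrow> point \<Rightarrow> point" where
  "collapse k b = (\<lambda>(l, j). (if l \<le> k then l else if l \<le> k + b then k else l - b, j))"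

end

theory Submission
  imports Defs
begin

text \<open>
  The state \<open>\<alpha>'\<close> smooths every crossing of the inserted braid vertically: \<open>\<tau>\<close> by its 0-smoothing and
  \<open>\<tau>\<^sup>-\<^sup>1\<close> by its 1-smoothing.  The smoothed braid is a bundle of straight strands, so collapsing its
  box to the transverse line turns the smoothed \<open>D'\<close> into the smoothed \<open>D\<close> without changing the
  pattern of loops.  The marking of \<open>\<alpha>'\<close> is the marking of \<open>\<alpha>\<close> pulled back along this collapse
  (\<open>collapse_loops\<close>).  All comparisons of smoothed diagrams below have this form; the locale \<open>box\<close>
  treats them at once, including boxes that contain closed circles.

  Distinct crossings lead to distinct states, so \<open>d(\<alpha>') = 0\<close> means that no
  single change of a smoothing contributes (\<open>state_cycle_iff\<close>).  A change at a crossing of \<open>D\<close> takes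
  place outside the box and corresponds to the same saddle in \<open>D\<close>, where it contributes nothing
  because \<open>\<alpha>\<close> is a cycle (\<open>no_saddle_old_crossing\<close>).  A change at a crossing of the braid affects
  two strands that lie on different loops, both marked \<open>v\<^sub>-\<close>, because the arcs are braid-parallel.
  Neither loop survives the change, so the only possible contribution is a merge, and
  \<open>v\<^sub>- \<otimes> v\<^sub>-\<close> is sent to 0 (\<open>no_saddle_new_crossing\<close>).

  That \<open>\<alpha>'\<close> is sent to \<open>\<plusminus>\<alpha>\<close> is seen by following the basis vector through the movie: each
  step sends the state constructed as above for one braid word to the state for the next word, up
  to sign (\<open>jacobsson_ket\<close>).  At a Reidemeister II move the state has vertical strands, where the
  map is the identity up to sign (\<open>RII_map_ket\<close>).  When a central crossing is resolved, the saddle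
  splits a circle off a loop marked \<open>v\<^sub>-\<close>; since \<open>v\<^sub>-\<close> is sent to the single term
  \<open>v\<^sub>- \<otimes> v\<^sub>-\<close>, the circle is marked \<open>v\<^sub>-\<close>, and the Reidemeister I map removes it with coefficient 1
  (\<open>saddle_coeff_bent\<close>, \<open>resolve_map_ket\<close>).
\<close>


section \<open>Reachability in an undirected graph\<close>

abbreviation linked :: "('a \<times> 'a) set \<Rightarrow> ('a \<times> 'a) set" where
  "linked R \<equiv> (R \<union> R\<inverse>)\<^sup>*"

lemma linked_sym: "(x, y) \<in> linked R \<Longrightarrow> (y, x) \<in> linked R"
  by (metis sym_Un_converse sym_rtrancl symD)

lemma linked_mono: "(x, y) \<in> linked R \<Longrightarrow> R \<subseteq> Q \<Longrightarrow> (x, y) \<in> linked Q"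
  by (metis Un_mono converse_mono rtrancl_mono subsetD)

lemma linked_edge: "(x, y) \<in> R \<Longrightarrow> (x, y) \<in> linked R"
  by (rule r_into_rtrancl) simp

lemma linked_map:
  assumes "(x, y) \<in> linked R"
    and "\<And>x y. (x, y) \<in> R \<Longrightarrow> (f x, f y) \<in> linked Q"
  shows "(f x, f y) \<in> linked Q"
  using assms(1)
proof (induction rule: rtrancl_induct)
  case (step y z)
  from step.hyps(2) have "(f y, f z) \<in> linked Q"
    by (auto dest: assms(2) linked_sym)
  with step.IH show ?case
    by (rule rtrancl_trans)
qed simp

text \<open>
  Connectedness can be tested after a map \<open>r\<close> which sends edges to paths, has connected fibres, and
  along which every edge of the target lifts: a path downstairs is lifted edge by edge, and the
  lifted edges are joined within the fibres.  The target may have further points in the image of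
  \<open>r\<close> which meet no edge; their fibres are components of their own.
\<close>

lemma linked_retract:
  assumes edge: "\<And>x y. (x, y) \<in> R \<Longrightarrow> (r x, r y) \<in> linked Q"
    and fibre: "\<And>x y. x \<in> X \<Longrightarrow> y \<in> X \<Longrightarrow> r x = r y \<Longrightarrow> (x, y) \<in> linked R"
    and lift: "\<And>u v. (u, v) \<in> Q \<Longrightarrow> \<exists>x \<in> X. \<exists>y \<in> X. r x = u \<and> r y = v \<and> (x, y) \<in> linked R"
    and X: "x \<in> X" "y \<in> X"
  shows "(x, y) \<in> linked R \<longleftrightarrow> (r x, r y) \<in> linked Q"
proof
  show "(r x, r y) \<in> linked Q" if "(x, y) \<in> linked R"
    using that edge by (rule linked_map)
next
  have "\<forall>y \<in> X. r y = v \<longrightarrow> (x, y) \<in> linked R" if "(r x, v) \<in> linked Q" for v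
    using that
  proof (induction rule: rtrancl_induct)
    case base
    then show ?case using fibre[OF X(1)] by simp
  next
    case (step v v')
    have "(v, v') \<in> Q \<or> (v', v) \<in> Q"
      using step.hyps(2) by blast
    then obtain a b where ab: "a \<in> X" "b \<in> X" "r a = v" "r b = v'" "(a, b) \<in> linked R"
      by (elim disjE) (drule lift, blast intro: linked_sym)+
    show ?case
    proof (intro ballI impI)
      fix y assume "y \<in> X" "r y = v'"
      then have "(b, y) \<in> linked R" using fibre[OF ab(2)] ab(4) by simp
      moreover have "(x, a) \<in> linked R" using step.IH ab(1,3) by simp
      ultimately show "(x, y) \<in> linked R" using ab(5) by (meson rtrancl_trans)
    qed
  qed
  then show "(r x, r y) \<in> linked Q \<Longrightarrow> (x, y) \<in> linked R"
    using X(2) by simp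
qed

section \<open>Tangles cut out of a diagram\<close>

text \<open>
  How the number of strands changes at a layer.  The clause for \<open>Cap\<close> is the length of the list
  that \<open>step\<close> computes even if the cap does not fit, so that \<open>width_fold\<close> holds for every list of
  layers.
\<close>

fun strands_above :: "layer \<Rightarrow> nat \<Rightarrow> nat" where
  "strands_above (Cup i u) w = w + 2"
| "strands_above (Cap i) w = min i w + (w - (i + 2))"
| "strands_above (Cross c t i) w = w"

fun in_range :: "layer \<Rightarrow> nat \<Rightarrow> bool" where
  "in_range (Cup i u) w \<longleftrightarrow> i \<le> w"
| "in_range (Cap i) w \<longleftrightarrow> i + 1 < w"
| "in_range (Cross c t i) w \<longleftrightarrow> i + 1 < w"

text \<open>
  Only the positions of the layers are checked, not the orientations at a cap.
\<close>

fun spans :: "nat \<Rightarrow> layer list \<Rightarrow> nat \<Rightarrow> bool" where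
  "spans w [] w' \<longleftrightarrow> w = w'"
| "spans w (x # xs) w' \<longleftrightarrow> in_range x w \<and> spans (strands_above x w) xs w'"

text \<open>
  The arcs and points of a smoothed tangle that starts with \<open>w\<close> strands at height \<open>t\<close>.  The height
  is a parameter in order that a tangle can be studied by itself, at height 0, and then be moved to
  its place in a diagram.
\<close>

fun box_links :: "nat set \<Rightarrow> nat \<Rightarrow> nat \<Rightarrow> layer list \<Rightarrow> (point \<times> point) set" where
  "box_links S t w [] = {}"
| "box_links S t w (x # xs) = links S t w x \<union> box_links S (Suc t) (strands_above x w) xs"

fun box_points :: "nat \<Rightarrow> nat \<Rightarrow> layer list \<Rightarrow> point set" where
  "box_points t w [] = {t} \<times> {..<w}"
| "box_points t w (x # xs) = {t} \<times> {..<w} \<union> box_points (Suc t) (strands_above x w) xs"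

definition up :: "nat \<Rightarrow> point \<Rightarrow> point" where
  "up n = (\<lambda>(l, j). (l + n, j))"

lemma up_simps [simp]: "up n (l, j) = (l + n, j)" "fst (up n x) = fst x + n" "snd (up n x) = snd x"
  by (auto simp: up_def split: prod.splits)

lemma length_step: "length (step x l) = strands_above x (length l)"
  by (cases x) (auto simp: min_def)

lemma length_fold_step: "length (fold step xs l) = fold strands_above xs (length l)"
  by (induction xs arbitrary: l) (simp_all add: length_step)

lemma width_fold: "width D k = fold strands_above (take k D) 0"
  by (simp add: width_def level_def length_fold_step)

lemma fold_spans: "spans w xs w' \<Longrightarrow> fold strands_above xs w = w'"
  by (induction xs arbitrary: w) auto

lemma spans_append:
  "spans w (xs @ ys) w'' \<longleftrightarrow>
    spans w xs (fold strands_above xs w) \<and> spans (fold strands_above xs w) ys w''"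
  by (induction xs arbitrary: w) auto

lemma spans_appendI: "spans w xs w' \<Longrightarrow> spans w' ys w'' \<Longrightarrow> spans w (xs @ ys) w''"
  using fold_spans by (fastforce simp: spans_append)

lemma box_links_append:
  "box_links S t w (xs @ ys) =
    box_links S t w xs \<union> box_links S (t + length xs) (fold strands_above xs w) ys"
  by (induction xs arbitrary: t w) auto

lemma box_points_bottom: "j < w \<Longrightarrow> (t, j) \<in> box_points t w xs"
  by (cases xs) auto

lemma box_points_append:
  "box_points t w (xs @ ys) =
    box_points t w xs \<union> box_points (t + length xs) (fold strands_above xs w) ys"
  by (induction xs arbitrary: t w) (auto simp: box_points_bottom)

lemma box_points_level: "x \<in> box_points t w xs \<Longrightarrow> t \<le> fst x \<and> fst x \<le> t + length xs"
  by (induction xs arbitrary: t w) fastforce+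

lemma mem_box_points:
  "(l, j) \<in> box_points t w xs \<longleftrightarrow>
    t \<le> l \<and> l \<le> t + length xs \<and> j < fold strands_above (take (l - t) xs) w"
proof (induction xs arbitrary: t w)
  case (Cons x xs)
  then show ?case
    by (cases "l = t") (auto simp: take_Cons' dest: box_points_level)
qed auto

lemma box_links_Union:
  "(\<Union>k<length xs. links S (t + k) (fold strands_above (take k xs) w) (xs ! k)) = box_links S t w xs"
proof (induction xs arbitrary: t w)
  case (Cons x xs)
  show ?case
    by (simp add: lessThan_Suc_eq_insert_0 flip: Cons.IH)
qed simp

lemma points_box: "points D = box_points 0 0 D"
  by (auto simp: points_def mem_box_points width_fold)

lemma connected_in_box: "connected_in D S = linked (box_links S 0 0 D)"
  using box_links_Union[where xs = D and t = 0 and w = 0 and S = S]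
  by (simp add: connected_in_def Let_def width_fold)

lemma links_up: "links S (t + n) w x = map_prod (up n) (up n) ` links S t w x"
proof (cases x)
  case (Cup i u)
  then show ?thesis by (force simp: image_iff)
next
  case (Cap i)
  then show ?thesis by (force simp: image_iff)
next
  case (Cross c t i)
  then show ?thesis by (force simp: image_iff)
qed

lemma box_links_up: "box_links S (t + n) w xs = map_prod (up n) (up n) ` box_links S t w xs"
  by (induction xs arbitrary: t w) (simp_all add: links_up image_Un flip: add_Suc)

lemma links_in_range:
  assumes "in_range x w" "(y, z) \<in> links S t w x"
  shows "y \<in> {t} \<times> {..<w} \<union> {Suc t} \<times> {..<strands_above x w}"
    and "z \<in> {t} \<times> {..<w} \<union> {Suc t} \<times> {..<strands_above x w}"
  using assms by (cases x; auto split: if_splits)+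

lemma box_links_points:
  assumes "spans w xs w'" "(y, z) \<in> box_links S t w xs"
  shows "y \<in> box_points t w xs \<and> z \<in> box_points t w xs"
  using assms
proof (induction xs arbitrary: t w)
  case (Cons x xs)
  then show ?case
    using links_in_range[of x w y z S t] box_points_bottom
    by fastforce
qed simp

lemma linked_box_points:
  assumes "(y, z) \<in> linked (box_links S t w xs)" "spans w xs w'" "y \<in> box_points t w xs"
  shows "z \<in> box_points t w xs"
  using assms(1,3)
  by (induction rule: rtrancl_induct) (use box_links_points[OF assms(2)] in blast)+

lemma link_diagram_spans:
  assumes "link_diagram D"
  shows "spans 0 D 0"
proof -
  have "spans 0 (take k D) (width D k)" if "k \<le> length D" for k
    using that
  proof (induction k)
    case (Suc k)
    then have "fits (D ! k) (level D k)"
      using assms by (simp add: link_diagram_def)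
    then have "in_range (D ! k) (width D k)"
      by (cases "D ! k") (simp_all add: width_def)
    moreover have "width D (Suc k) = strands_above (D ! k) (width D k)"
      using Suc.prems by (simp add: width_fold take_Suc_conv_app_nth)
    moreover have "spans 0 (take k D) (width D k)"
      using Suc by simp
    ultimately show ?case
      using Suc.prems by (simp add: take_Suc_conv_app_nth spans_appendI)
  qed (simp add: width_fold)
  from this[of "length D"] show ?thesis
    using assms by (simp add: width_def link_diagram_def)
qed


section \<open>Loops and their traces\<close>

lemma mem_loop_of: "y \<in> loop_of D S x \<longleftrightarrow> (x, y) \<in> connected_in D S"
  by (simp add: loop_of_def)

lemma loop_of_self: "x \<in> loop_of D S x"
  by (simp add: mem_loop_of connected_in_box)

lemma loop_of_eq: "(x, y) \<in> connected_in D S \<Longrightarrow> loop_of D S y = loop_of D S x"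
  unfolding set_eq_iff mem_loop_of connected_in_box
  by (meson linked_sym rtrancl_trans)

lemma loop_of_in_loops: "x \<in> points D \<Longrightarrow> loop_of D S x \<in> loops D S"
  by (simp add: loops_def)

lemma loops_eq_loop_of: "K \<in> loops D S \<Longrightarrow> x \<in> K \<Longrightarrow> K = loop_of D S x"
  by (metis imageE loop_of_eq loops_def mem_loop_of)

lemma loops_nonempty: "K \<in> loops D S \<Longrightarrow> K \<noteq> {}"
  using loop_of_self by (fastforce simp: loops_def)

text \<open>
  The loops are the classes of an equivalence relation; this is used below in the form that two
  loops with a common point are equal.
\<close>

lemma loops_disjoint: "K \<in> loops D S \<Longrightarrow> L \<in> loops D S \<Longrightarrow> x \<in> K \<Longrightarrow> x \<in> L \<Longrightarrow> K = L"
  by (metis loops_eq_loop_of)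

lemma connected_points:
  "(x, y) \<in> connected_in D S \<Longrightarrow> spans 0 D w \<Longrightarrow> x \<in> points D \<Longrightarrow> y \<in> points D"
  unfolding connected_in_box points_box by (rule linked_box_points)

lemma loops_subset: "spans 0 D w \<Longrightarrow> K \<in> loops D S \<Longrightarrow> K \<subseteq> points D"
  by (auto simp: loops_def mem_loop_of intro: connected_points)

lemma Inl_trace: "Inl x \<in> trace a b K \<longleftrightarrow> x \<in> K \<and> fst x \<le> a"
  by (auto simp: trace_def)

lemma Inr_trace: "Inr (h, j) \<in> trace a b K \<longleftrightarrow> (a + b + h, j) \<in> K"
  by (force simp: trace_def)

lemma trace_eqI:
  assumes "\<And>l j. l \<le> a \<Longrightarrow> (l, j) \<in> K \<longleftrightarrow> (l, j) \<in> L"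
    and "\<And>h j. (a + b + h, j) \<in> K \<longleftrightarrow> (a + b' + h, j) \<in> L"
  shows "trace a b K = trace a b' L"
proof (rule set_eqI)
  fix x
  show "x \<in> trace a b K \<longleftrightarrow> x \<in> trace a b' L"
    using assms by (cases x; cases "projl x"; cases "projr x") (auto simp: Inl_trace Inr_trace)
qed

lemma trace_Un: "trace a b (K \<union> L) = trace a b K \<union> trace a b L"
  by (auto simp: trace_def)

text \<open>
  A point of the trace of a loop comes from only one point of the loop.  Hence different loops have
  disjoint traces, and a loop with a nonempty trace is determined by its trace.
\<close>

lemma trace_disjoint:
  assumes "T \<in> trace a b K" "T \<in> trace a b L"
  shows "K \<inter> L \<noteq> {}"
proof (cases T)
  case (Inl x)
  then show ?thesis using assms by (auto simp: Inl_trace)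
next
  case (Inr x)
  then show ?thesis using assms by (cases x) (auto simp: Inr_trace)
qed

lemma trace_inj_loops:
  assumes "K \<in> loops D S" "L \<in> loops D S" "trace a b K = trace a b L" "trace a b K \<noteq> {}"
  shows "K = L"
  using assms trace_disjoint loops_disjoint by (metis disjoint_iff ex_in_conv)

text \<open>
  Around a box of height 0 every point is outer, so the trace loses nothing.
\<close>

lemma trace_0_nonempty: "K \<noteq> {} \<Longrightarrow> trace a 0 K \<noteq> {}"
proof -
  assume "K \<noteq> {}"
  then obtain l j where "(l, j) \<in> K" by auto
  then have "Inl (l, j) \<in> trace a 0 K \<or> Inr (l - a, j) \<in> trace a 0 K"
    by (cases "l \<le> a") (auto simp: Inl_trace Inr_trace)
  then show ?thesis by blast
qed

text \<open>
  The definite description in \<open>outer\<close> is justified by \<open>trace_inj_loops\<close>.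
\<close>

lemma outer_trace:
  assumes "dom m = loops D S" "K \<in> loops D S" "trace a b K \<noteq> {}"
  shows "outer a b m (trace a b K) = m K"
proof -
  have "(THE L. L \<in> dom m \<and> trace a b L = trace a b K) = K"
    using assms trace_inj_loops by (intro the_equality) metis+
  then show ?thesis
    using assms by (auto simp: outer_def)
qed

lemma outer_cases:
  assumes "dom m = loops D S"
  obtains K where "K \<in> loops D S" "T = trace a b K" "T \<noteq> {}" "outer a b m T = m K"
  | "outer a b m T = None" "\<And>K. K \<in> loops D S \<Longrightarrow> T = trace a b K \<Longrightarrow> T = {}"
proof (cases "T \<noteq> {} \<and> (\<exists>K \<in> loops D S. trace a b K = T)")
  case True
  then show ?thesis using that(1) outer_trace[OF assms] by metis
next
  case False
  then have "outer a b m T = None" using assms by (auto simp: outer_def)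
  with False show ?thesis using that(2) by metis
qed

lemma dom_outer:
  assumes "dom m = loops D S"
  shows "dom (outer a b m) = trace a b ` loops D S - {{}}"
proof (rule set_eqI)
  fix T
  show "T \<in> dom (outer a b m) \<longleftrightarrow> T \<in> trace a b ` loops D S - {{}}"
  proof (cases "T \<in> trace a b ` loops D S - {{}}")
    case True
    then obtain K where K: "K \<in> loops D S" "T = trace a b K" "T \<noteq> {}" by blast
    moreover have "m K \<noteq> None" using K(1) assms by blast
    ultimately show ?thesis using outer_trace[OF assms, of K a b] by auto
  next
    case False
    then have "outer a b m T = None" using assms by (auto simp: outer_def)
    with False show ?thesis by (simp add: domIff)
  qed
qed

lemma outer_determines:
  assumes "dom m = loops D S" "dom m' = loops D S"
    and "\<And>K. K \<in> loops D S \<Longrightarrow> trace a b K \<noteq> {}"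
    and "outer a b m = outer a b m'"
  shows "m = m'"
proof
  fix K
  show "m K = m' K"
  proof (cases "K \<in> loops D S")
    case True
    then show ?thesis
      using outer_trace[OF assms(1)] outer_trace[OF assms(2)] assms(3,4) by metis
  next
    case False
    then show ?thesis using assms(1,2) by (metis domIff)
  qed
qed

section \<open>Collapsing a box to a line\<close>

text \<open>
  The box of height \<open>b\<close> above height \<open>a\<close> is collapsed to the line at height \<open>a\<close>.  The function
  \<open>\<phi>\<close>, in the local coordinates of the box, tells on which strand of that line a point of the box
  is sent.  A number which is too large for a strand is allowed as well: it serves for circles
  inside the box, which are sent to a point off the collapsed diagram.
\<close>

definition retract :: "nat \<Rightarrow> nat \<Rightarrow> (point \<Rightarrow> nat) \<Rightarrow> point \<Rightarrow> point" where
  "retract a b \<phi> = (\<lambda>(l, j).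
     if l < a then (l, j) else if l \<le> a + b then (a, \<phi> (l - a, j)) else (l - b, j))"

lemma collapse_retract: "collapse k b = retract k b snd"
  by (auto simp: collapse_def retract_def fun_eq_iff)

text \<open>
  The marking of loops pulled back along a collapse.  A loop without an image is a circle inside
  the box; it is marked \<open>v\<^sub>-\<close>, which is the mark of a circle split off a loop marked \<open>v\<^sub>-\<close> and the
  mark that the counit sends to 1.
\<close>

definition pull :: "diagram \<Rightarrow> nat set \<Rightarrow> (point \<Rightarrow> point) \<Rightarrow> point marking \<Rightarrow> point marking" where
  "pull D S r m = (\<lambda>K. if K \<in> loops D S
     then Some (case m (r ` K) of None \<Rightarrow> Minus | Some v \<Rightarrow> v) else None)"

lemma dom_pull [simp]: "dom (pull D S r m) = loops D S"
  by (auto simp: pull_def split: if_splits)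

lemma pull_eq: "K \<in> loops D S \<Longrightarrow> r ` K \<in> dom m \<Longrightarrow> pull D S r m K = m (r ` K)"
  by (auto simp: pull_def)

lemma pull_outside: "K \<in> loops D S \<Longrightarrow> r ` K \<notin> dom m \<Longrightarrow> pull D S r m K = Some Minus"
  by (auto simp: pull_def domIff)

text \<open>
  The box \<open>P\<close> between \<open>U\<close> and \<open>W\<close>, smoothed by \<open>S\<close>, consists of arcs that connect each strand at
  its bottom with the strand of the same number at its top, and possibly of circles: \<open>\<phi>\<close> is constant
  along the arcs, and its fibres are connected inside the box.
\<close>

locale box =
  fixes U P W :: "layer list" and S :: "nat set" and w :: nat and \<phi> :: "point \<Rightarrow> nat"
  assumes below: "spans 0 U w" and inside: "spans w P w" and above: "spans w W 0"
    and bottom: "\<phi> (0, j) = j" and top: "\<phi> (length P, j) = j"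
    and along: "(x, y) \<in> box_links S 0 w P \<Longrightarrow> \<phi> x = \<phi> y"
    and fibre: "x \<in> box_points 0 w P \<Longrightarrow> y \<in> box_points 0 w P \<Longrightarrow> \<phi> x = \<phi> y \<Longrightarrow>
      (x, y) \<in> linked (box_links S 0 w P)"
begin

abbreviation "r \<equiv> retract (length U) (length P) \<phi>"

lemma spans_E: "spans 0 (U @ P @ W) 0" and spans_F: "spans 0 (U @ W) 0"
  using below inside above by (auto intro: spans_appendI)

lemma r_low: "l \<le> length U \<Longrightarrow> r (l, j) = (l, j)"
  using bottom by (auto simp: retract_def)

lemma r_high: "length U \<le> l \<Longrightarrow> r (l + length P, j) = (l, j)"
  using top by (auto simp: retract_def)

lemma r_mid: "r (length U + l, j) = (length U, \<phi> (l, j))" if "l \<le> length P"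
  using that by (auto simp: retract_def)

lemma points_low: "l \<le> length U \<Longrightarrow> (l, j) \<in> points (U @ P @ W) \<longleftrightarrow> (l, j) \<in> points (U @ W)"
  by (auto simp: points_def width_fold)

lemma points_high:
  "length U \<le> l \<Longrightarrow> (l + length P, j) \<in> points (U @ P @ W) \<longleftrightarrow> (l, j) \<in> points (U @ W)"
  using fold_spans[OF below] fold_spans[OF inside] by (auto simp: points_def width_fold)

lemma points_mid:
  "l \<le> length P \<Longrightarrow> (length U + l, j) \<in> points (U @ P @ W) \<longleftrightarrow> (l, j) \<in> box_points 0 w P"
  using fold_spans[OF below] by (auto simp: points_def width_fold mem_box_points)

lemma level_cases:
  obtains (low) l j where "x = (l, j)" "l < length U"
  | (mid) l j where "x = (length U + l, j)" "l \<le> length P"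
  | (high) l j where "x = (l + length P, j)" "length U < l"
proof -
  obtain l j where x: "x = (l, j)" by (cases x)
  consider "l < length U" | "length U \<le> l" "l \<le> length U + length P" | "length U + length P < l"
    by linarith
  then show ?thesis
  proof cases
    case 1 with x low show ?thesis by blast
  next
    case 2 with x mid[of "l - length U" j] show ?thesis by auto
  next
    case 3 with x high[of "l - length P" j] show ?thesis by auto
  qed
qed

text \<open>
  The collapse is onto, also if the box carries no points of its own: the points above the line are
  lifted to points above the box.
\<close>

lemma section_r:
  assumes "y \<in> points (U @ W)"
  obtains x where "x \<in> points (U @ P @ W)" "r x = y"
proof (cases "fst y \<le> length U")
  case True
  then show ?thesis using that[of y] assms r_low points_low by (metis prod.collapse)
next
  case False
  then show ?thesis
    using that[of "(fst y + length P, snd y)"] assms r_high points_high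
    by (metis linorder_le_cases prod.collapse)
qed

lemma links_E: "box_links S 0 0 (U @ P @ W) = box_links S 0 0 U \<union>
    map_prod (up (length U)) (up (length U)) ` box_links S 0 w P \<union>
    map_prod (up (length P)) (up (length P)) ` box_links S (length U) w W"
  using box_links_up[of S 0 "length U" w P]
  by (simp add: box_links_append fold_spans[OF below] fold_spans[OF inside] Un_assoc
      flip: box_links_up)

lemma links_F: "box_links S 0 0 (U @ W) = box_links S 0 0 U \<union> box_links S (length U) w W"
  by (simp add: box_links_append fold_spans[OF below])

text \<open>
  The collapse meets the conditions of \<open>linked_retract\<close>.  Two points in one fibre either coincide or
  both belong to the box, and the edges of the collapsed diagram all lie outside the box.
\<close>

lemma connected_iff:
  assumes "x \<in> points (U @ P @ W)" "y \<in> points (U @ P @ W)"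
  shows "(x, y) \<in> connected_in (U @ P @ W) S \<longleftrightarrow> (r x, r y) \<in> connected_in (U @ W) S"
  unfolding connected_in_box
proof (rule linked_retract[OF _ _ _ assms])
  fix x y assume "(x, y) \<in> box_links S 0 0 (U @ P @ W)"
  then consider (U) "(x, y) \<in> box_links S 0 0 U"
    | (P) x' y' where "(x', y') \<in> box_links S 0 w P" "x = up (length U) x'" "y = up (length U) y'"
    | (W) x' y' where "(x', y') \<in> box_links S (length U) w W"
        "x = up (length P) x'" "y = up (length P) y'"
    unfolding links_E by auto
  then show "(r x, r y) \<in> linked (box_links S 0 0 (U @ W))"
  proof cases
    case U
    have "fst x \<le> length U" "fst y \<le> length U"
      using box_links_points[OF below U] box_points_level by fastforce+
    then have "r x = x" "r y = y" using r_low by (metis prod.collapse)+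
    with U show ?thesis by (simp add: links_F linked_edge)
  next
    case P
    have "fst x' \<le> length P" "fst y' \<le> length P"
      using box_links_points[OF inside P(1)] box_points_level by fastforce+
    then have "r x = r y"
      using r_mid along[OF P(1)] P(2,3)
      by (metis add.commute prod.collapse up_simps(1))
    then show ?thesis by simp
  next
    case W
    have "length U \<le> fst x'" "length U \<le> fst y'"
      using box_links_points[OF above W(1)] box_points_level by fastforce+
    then have "r x = x'" "r y = y'" using r_high W(2,3) by (metis prod.collapse up_simps(1))+
    with W show ?thesis by (simp add: links_F linked_edge)
  qed
next
  fix x y assume xy: "x \<in> points (U @ P @ W)" "y \<in> points (U @ P @ W)" "r x = r y"
  consider "x = y" | l j l' j' where "x = (length U + l, j)" "l \<le> length P"
      "y = (length U + l', j')" "l' \<le> length P"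
    by (rule level_cases[of x]; rule level_cases[of y])
      (use xy(3) in \<open>auto simp: r_low r_mid r_high\<close>)
  then show "(x, y) \<in> linked (box_links S 0 0 (U @ P @ W))"
  proof cases
    case 2
    then have "(l, j) \<in> box_points 0 w P" "(l', j') \<in> box_points 0 w P" "\<phi> (l, j) = \<phi> (l', j')"
      using xy points_mid r_mid by auto
    then have "((l, j), (l', j')) \<in> linked (box_links S 0 w P)"
      using fibre by blast
    then have "(up (length U) (l, j), up (length U) (l', j')) \<in> linked (box_links S 0 0 (U @ P @ W))"
      by (rule linked_map) (force simp: links_E intro!: linked_edge)
    with 2 show ?thesis by (simp add: add.commute)
  qed simp
next
  fix u v assume "(u, v) \<in> box_links S 0 0 (U @ W)"
  then consider (U) "(u, v) \<in> box_links S 0 0 U" | (W) "(u, v) \<in> box_links S (length U) w W"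
    unfolding links_F by blast
  then show "\<exists>x \<in> points (U @ P @ W). \<exists>y \<in> points (U @ P @ W).
    r x = u \<and> r y = v \<and> (x, y) \<in> linked (box_links S 0 0 (U @ P @ W))"
  proof cases
    case U
    have "u \<in> points (U @ P @ W)" "v \<in> points (U @ P @ W)" "fst u \<le> length U" "fst v \<le> length U"
      using box_links_points[OF below U] box_points_level
      by (fastforce simp: points_box box_points_append)+
    moreover from this have "r u = u" "r v = v" using r_low by (metis prod.collapse)+
    ultimately show ?thesis using U by (auto simp: links_E intro!: linked_edge)
  next
    case W
    let ?x = "up (length P) u" and ?y = "up (length P) v"
    have "u \<in> points (U @ W)" "v \<in> points (U @ W)" "length U \<le> fst u" "length U \<le> fst v"
      using box_links_points[OF above W] box_points_level
      by (fastforce simp: points_box box_points_append fold_spans[OF below])+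
    then have "?x \<in> points (U @ P @ W)" "?y \<in> points (U @ P @ W)" "r ?x = u" "r ?y = v"
      using r_high points_high by (metis prod.collapse up_simps(1))+
    moreover have "(?x, ?y) \<in> linked (box_links S 0 0 (U @ P @ W))"
      using W by (force simp: links_E intro!: linked_edge)
    ultimately show ?thesis by blast
  qed
qed

lemma loop_of_box:
  assumes "x \<in> points (U @ P @ W)"
  shows "loop_of (U @ P @ W) S x =
    {y \<in> points (U @ P @ W). (r x, r y) \<in> connected_in (U @ W) S}"
  using connected_points[OF _ spans_E assms] connected_iff[OF assms] mem_loop_of by blast

lemma image_loop_of:
  assumes "x \<in> points (U @ P @ W)" "r x \<in> points (U @ W)"
  shows "r ` loop_of (U @ P @ W) S x = loop_of (U @ W) S (r x)"
proof (intro equalityI subsetI)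
  fix y assume y: "y \<in> loop_of (U @ W) S (r x)"
  then have "y \<in> points (U @ W)"
    using assms(2) connected_points[OF _ spans_F] mem_loop_of by blast
  then obtain z where "z \<in> points (U @ P @ W)" "r z = y" by (rule section_r)
  with y show "y \<in> r ` loop_of (U @ P @ W) S x"
    by (auto simp: loop_of_box[OF assms(1)] mem_loop_of)
qed (auto simp: loop_of_box[OF assms(1)] mem_loop_of)

text \<open>
  A loop either lies over a loop of the collapsed diagram or misses that diagram entirely; one of its
  points decides which.
\<close>

lemma image_loop_iff:
  assumes "K \<in> loops (U @ P @ W) S" "x \<in> K"
  shows "r ` K \<in> loops (U @ W) S \<longleftrightarrow> r x \<in> points (U @ W)"
proof -
  have K: "K = loop_of (U @ P @ W) S x" "x \<in> points (U @ P @ W)"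
    using assms loops_eq_loop_of loops_subset[OF spans_E] by blast+
  show ?thesis
  proof
    assume "r ` K \<in> loops (U @ W) S"
    then show "r x \<in> points (U @ W)" using loops_subset[OF spans_F] assms(2) by blast
  next
    assume "r x \<in> points (U @ W)"
    then show "r ` K \<in> loops (U @ W) S" using K image_loop_of loop_of_in_loops by simp
  qed
qed

text \<open>
  A loop is a union of fibres, so it can be recovered from its image.
\<close>

lemma saturated:
  assumes "K \<in> loops (U @ P @ W) S"
  shows "K = {x \<in> points (U @ P @ W). r x \<in> r ` K}"
proof -
  from assms obtain x where x: "x \<in> points (U @ P @ W)" "K = loop_of (U @ P @ W) S x"
    by (auto simp: loops_def)
  show ?thesis
    unfolding x(2) loop_of_box[OF x(1)] by auto
qed

lemma preimage_loop:
  assumes "L \<in> loops (U @ W) S"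
  shows "{x \<in> points (U @ P @ W). r x \<in> L} \<in> loops (U @ P @ W) S"
    and "r ` {x \<in> points (U @ P @ W). r x \<in> L} = L"
proof -
  obtain y where y: "y \<in> points (U @ W)" "L = loop_of (U @ W) S y"
    using assms by (auto simp: loops_def)
  obtain x where x: "x \<in> points (U @ P @ W)" "r x = y" using section_r y(1) by blast
  have "loop_of (U @ P @ W) S x = {x \<in> points (U @ P @ W). r x \<in> L}"
    using loop_of_box[OF x(1)] x(2) y(2) by (auto simp: mem_loop_of)
  then show "{x \<in> points (U @ P @ W). r x \<in> L} \<in> loops (U @ P @ W) S"
    using loop_of_in_loops[OF x(1), of S] by simp
  show "r ` {x \<in> points (U @ P @ W). r x \<in> L} = L"
  proof (intro equalityI subsetI)
    fix z assume z: "z \<in> L"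
    then have "z \<in> points (U @ W)" using loops_subset[OF spans_F assms] by blast
    then obtain x' where "x' \<in> points (U @ P @ W)" "r x' = z" by (rule section_r)
    with z show "z \<in> r ` {x \<in> points (U @ P @ W). r x \<in> L}" by blast
  qed blast
qed

text \<open>
  The collapse identifies the outer points of the two diagrams, and the heights above the box are
  counted from its top.
\<close>

lemma trace_box:
  assumes K: "K \<in> loops (U @ P @ W) S" and L: "r ` K \<in> loops (U @ W) S"
  shows "trace (length U) (length P) K = trace (length U) 0 (r ` K)"
proof (rule trace_eqI)
  note iff = saturated[OF K, unfolded set_eq_iff, rule_format]
  note sub = loops_subset[OF spans_F L]
  fix l j assume "l \<le> length U"
  then show "(l, j) \<in> K \<longleftrightarrow> (l, j) \<in> r ` K"
    using iff[of "(l, j)"] r_low points_low sub by auto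
next
  note iff = saturated[OF K, unfolded set_eq_iff, rule_format]
  note sub = loops_subset[OF spans_F L]
  fix h j
  show "(length U + length P + h, j) \<in> K \<longleftrightarrow> (length U + 0 + h, j) \<in> r ` K"
    using iff[of "(length U + h + length P, j)"] r_high[of "length U + h" j]
      points_high[of "length U + h" j] sub by (auto simp: ac_simps)
qed

text \<open>
  All outer points are sent into the collapsed diagram, so a loop that misses it has none.
\<close>

lemma trace_circle:
  assumes K: "K \<in> loops (U @ P @ W) S" and L: "r ` K \<notin> loops (U @ W) S"
  shows "trace (length U) (length P) K = {}"
proof (rule ccontr)
  assume "trace (length U) (length P) K \<noteq> {}"
  then obtain T where T: "T \<in> trace (length U) (length P) K" by blast
  have "\<exists>x \<in> K. r x \<in> points (U @ W)"
  proof (cases T)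
    case (Inl x)
    obtain l j where x: "x = (l, j)" by (cases x)
    with Inl T have "(l, j) \<in> K" "l \<le> length U" by (simp_all add: Inl_trace)
    moreover from this have "r (l, j) \<in> points (U @ W)"
      using loops_subset[OF spans_E K] r_low[of l j] points_low[of l j] by auto
    ultimately show ?thesis by blast
  next
    case (Inr x)
    obtain h j where x: "x = (h, j)" by (cases x)
    with Inr T have "(length U + h + length P, j) \<in> K" by (simp add: Inr_trace ac_simps)
    moreover from this have "r (length U + h + length P, j) \<in> points (U @ W)"
      using loops_subset[OF spans_E K] r_high[of "length U + h" j] points_high[of "length U + h" j]
      by auto
    ultimately show ?thesis by blast
  qed
  then show False using image_loop_iff[OF K] L by blast
qed

text \<open>
  Seen from outside the box, a pulled back marking is the original marking.  This reduces the
  comparison of two fillings of a box to the comparison of each of them with the empty filling.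
\<close>

lemma outer_pull:
  assumes m: "dom m = loops (U @ W) S"
  shows "outer (length U) (length P) (pull (U @ P @ W) S r m) = outer (length U) 0 m"
    (is "?o = ?o'")
proof
  fix T
  show "?o T = ?o' T"
  proof (rule outer_cases[OF dom_pull, of "U @ P @ W" S T "length U" "length P" r m])
    fix K assume K: "K \<in> loops (U @ P @ W) S" "T = trace (length U) (length P) K" "T \<noteq> {}"
      "?o T = pull (U @ P @ W) S r m K"
    then have L: "r ` K \<in> loops (U @ W) S" using trace_circle by blast
    then have "?o' T = m (r ` K)"
      using K outer_trace[OF m L, of "length U" 0] trace_box by simp
    with K L show ?thesis using m by (simp add: pull_eq)
  next
    assume *: "?o T = None"
      "\<And>K. K \<in> loops (U @ P @ W) S \<Longrightarrow> T = trace (length U) (length P) K \<Longrightarrow> T = {}"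
    have "?o' T = None"
    proof (rule outer_cases[OF m, of T "length U" 0])
      fix L assume L: "L \<in> loops (U @ W) S" "T = trace (length U) 0 L" "T \<noteq> {}"
      note pre = preimage_loop[OF L(1)]
      have "T = trace (length U) (length P) {x \<in> points (U @ P @ W). r x \<in> L}"
        using trace_box[OF pre(1)] pre(2) L by simp
      then show ?thesis using *(2)[OF pre(1)] L(3) by blast
    qed
    with * show ?thesis by simp
  qed
qed

end


section \<open>Enhanced states as basis vectors\<close>

lemma finite_points: "finite (points D)"
proof -
  have "points D = Sigma {..length D} (\<lambda>k. {..<width D k})"
    by (auto simp: points_def)
  then show ?thesis by simp
qed

lemma finite_estates: "finite (estates D)"
proof (rule finite_subset)
  let ?M = "\<lambda>S. {m. dom m = loops D S \<and> ran m \<subseteq> {Plus, Minus}}"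
  show "estates D \<subseteq> (SIGMA S : Pow (crossings D). ?M S)"
    using mark.exhaust by (auto simp: estates_def)
  show "finite (SIGMA S : Pow (crossings D). ?M S)"
    using finite_points
    by (intro finite_SigmaI finite_set_of_finite_maps) (auto simp: crossings_def loops_def)
qed

lemma lin_ket:
  assumes "\<alpha> \<in> estates D"
  shows "lin D E a (ket \<alpha>) = (\<lambda>\<beta>. if \<beta> \<in> estates E then a \<alpha> \<beta> else 0)"
proof -
  have "(\<Sum>\<gamma> \<in> estates D. ket \<alpha> \<gamma> * a \<gamma> \<beta>) = (\<Sum>\<gamma> \<in> {\<alpha>}. a \<gamma> \<beta>)" for \<beta>
    using assms finite_estates by (intro sum.mono_neutral_cong_right) (auto simp: ket_def)
  then show ?thesis by (simp add: lin_def fun_eq_iff)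
qed

text \<open>
  The form in which all elementary chain maps are evaluated below: a matrix row with one nonzero
  entry.
\<close>

lemma lin_ket_eq:
  assumes "\<alpha> \<in> estates D" "\<gamma> \<in> estates E"
    and "\<And>\<beta>. \<beta> \<in> estates E \<Longrightarrow> a \<alpha> \<beta> = s * of_bool (\<beta> = \<gamma>)"
  shows "lin D E a (ket \<alpha>) = scale s (ket \<gamma>)"
  unfolding lin_ket[OF assms(1)] using assms(2,3) by (auto simp: ket_def scale_def fun_eq_iff)

lemma scale_1 [simp]: "scale 1 x = x"
  by (simp add: scale_def)

lemma scale_scale [simp]: "scale q (scale s x) = scale (q * s) x"
  by (simp add: scale_def ac_simps)

lemma lin_scale: "lin D E a (scale s x) = scale s (lin D E a x)"
  by (auto simp: lin_def scale_def sum_distrib_left mult.assoc fun_eq_iff)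

lemma saddle_coeff_eq_0: "saddle_coeff m m' = 0 \<longleftrightarrow> \<not> merges m m' \<and> \<not> splits m m'"
  by (auto simp: saddle_coeff_def)

text \<open>
  The changes at different crossings lead to different states, hence their contributions to \<open>d\<close>
  cannot cancel.
\<close>

lemma state_cycle_iff:
  "state_cycle D (S, m) \<longleftrightarrow> (S, m) \<in> estates D \<and>
    (\<forall>c \<in> crossings D - S. \<forall>m'. dom m' = loops D (insert c S) \<longrightarrow> \<not> merges m m' \<and> \<not> splits m m')"
proof (cases "(S, m) \<in> estates D")
  case True
  then have S: "S \<subseteq> crossings D" by (simp add: estates_def)
  have coeff: "diff_coeff D (S, m) (insert c S, m') =
      (-1) ^ card {x \<in> S. x < c} * saddle_coeff m m'" if c: "c \<in> crossings D - S" for c and m' :: "point marking"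
  proof -
    have "diff_coeff D (S, m) (insert c S, m') =
        (\<Sum>d \<in> {c}. (-1) ^ card {x \<in> S. x < d} * saddle_coeff m m')"
      unfolding diff_coeff.simps using c
      by (intro sum.mono_neutral_cong_right) (auto simp: crossings_def)
    then show ?thesis by simp
  qed
  have "diff D (ket (S, m)) = (\<lambda>_. 0) \<longleftrightarrow>
      (\<forall>S' m'. (S', m') \<in> estates D \<longrightarrow> diff_coeff D (S, m) (S', m') = 0)"
    by (auto simp: diff_def lin_ket[OF True] fun_eq_iff)
  also have "\<dots> \<longleftrightarrow> (\<forall>c \<in> crossings D - S. \<forall>m'. dom m' = loops D (insert c S) \<longrightarrow>
      saddle_coeff m m' = 0)"
  proof (intro iffI allI ballI impI)
    fix c and m' :: "point marking"
    assume *: "\<forall>S' m'. (S', m') \<in> estates D \<longrightarrow> diff_coeff D (S, m) (S', m') = 0"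
      "c \<in> crossings D - S" "dom m' = loops D (insert c S)"
    then have "(insert c S, m') \<in> estates D" using S by (simp add: estates_def)
    with *(1) have "diff_coeff D (S, m) (insert c S, m') = 0" by blast
    then show "saddle_coeff m m' = 0" 
      using coeff[OF *(2), of m'] by (simp del: diff_coeff.simps)
  next
    fix S' and m' :: "point marking"
    assume *: "\<forall>c \<in> crossings D - S. \<forall>m'. dom m' = loops D (insert c S) \<longrightarrow>
      saddle_coeff m m' = 0" "(S', m') \<in> estates D"
    show "diff_coeff D (S, m) (S', m') = 0"
      unfolding diff_coeff.simps
      by (rule sum.neutral) (use * in \<open>auto simp: estates_def\<close>)
  qed
  finally show ?thesis
    using True by (simp add: state_cycle_def saddle_coeff_eq_0)
qed (simp add: state_cycle_def)

section \<open>Saddles between loops\<close>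

lemma mergesE:
  assumes "merges m m'"
  obtains A B where "A \<in> dom m" "B \<in> dom m" "A \<noteq> B"
    "dom m' = insert (A \<union> B) (dom m - {A, B})"
    "\<forall>K \<in> dom m - {A, B}. m' K = m K" "m' (A \<union> B) = mult (the (m A)) (the (m B))"
  using assms unfolding merges_def by (elim exE conjE) (rule that)

lemma splitsE:
  assumes "splits m m'"
  obtains A B where "A \<in> dom m'" "B \<in> dom m'" "A \<noteq> B"
    "dom m = insert (A \<union> B) (dom m' - {A, B})"
    "\<forall>K \<in> dom m' - {A, B}. m' K = m K" "(the (m' A), the (m' B)) \<in> comult (the (m (A \<union> B)))"
  using assms unfolding splits_def by (elim exE conjE) (rule that)

lemma mergesI:
  assumes "A \<in> dom m" "B \<in> dom m" "A \<noteq> B" "dom m' = insert (A \<union> B) (dom m - {A, B})"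
    "\<And>K. K \<in> dom m - {A, B} \<Longrightarrow> m' K = m K" "m' (A \<union> B) = mult (the (m A)) (the (m B))"
  shows "merges m m'"
  unfolding merges_def using assms by (intro exI[of _ A] exI[of _ B] conjI ballI)

lemma splitsI:
  assumes "A \<in> dom m'" "B \<in> dom m'" "A \<noteq> B" "dom m = insert (A \<union> B) (dom m' - {A, B})"
    "\<And>K. K \<in> dom m' - {A, B} \<Longrightarrow> m' K = m K"
    "(the (m' A), the (m' B)) \<in> comult (the (m (A \<union> B)))"
  shows "splits m m'"
  unfolding splits_def using assms by (intro exI[of _ A] exI[of _ B] conjI ballI)

text \<open>
  A saddle that destroys two loops cannot be a split, which destroys one; and if it merges them, then
  the product of two marks \<open>v\<^sub>-\<close> is 0.
\<close>

lemma no_saddle_Minus: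
  assumes "A \<in> dom m" "B \<in> dom m" "A \<noteq> B" "m A = Some Minus" "m B = Some Minus"
    and "A \<notin> dom m'" "B \<notin> dom m'"
  shows "\<not> merges m m' \<and> \<not> splits m m'"
proof (intro conjI notI)
  assume "merges m m'"
  then obtain A' B' where *: "A' \<noteq> B'" "dom m' = insert (A' \<union> B') (dom m - {A', B'})"
    "m' (A' \<union> B') = mult (the (m A')) (the (m B'))"
    by (rule mergesE)
  have "dom m - {A', B'} \<subseteq> dom m'" unfolding *(2) by (rule subset_insertI)
  then have "A = A' \<or> A = B'" "B = A' \<or> B = B'" using assms(1,2,6,7) by auto
  then have "the (m A') = Minus" "the (m B') = Minus" using *(1) assms(3-5) by auto
  then have "A' \<union> B' \<notin> dom m'" using *(3) by (simp add: domIff)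
  then show False using *(2) by simp
next
  assume "splits m m'"
  then obtain A' B' where "dom m = insert (A' \<union> B') (dom m' - {A', B'})"
    by (rule splitsE)
  then have "dom m - {A' \<union> B'} \<subseteq> dom m'" by auto
  then have "A = A' \<union> B'" "B = A' \<union> B'" using assms(1,2,6,7) by auto
  then show False using assms(3) by simp
qed

text \<open>
  If the families of loops differ by splitting \<open>A \<union> B\<close>, then a split must be this one, and the
  coproduct of \<open>v\<^sub>-\<close> has a single term.
\<close>

lemma saddle_coeff_split_Minus:
  assumes m: "dom m = insert (A \<union> B) \<L>" "m (A \<union> B) = Some Minus"
    and m': "dom m' = insert A (insert B \<L>)"
    and disj: "A \<noteq> B" "A \<notin> dom m" "B \<notin> dom m"
  shows "saddle_coeff m m' =
    of_bool ((\<forall>K \<in> \<L>. m' K = m K) \<and> m' A = Some Minus \<and> m' B = Some Minus)"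
proof -
  have notin: "A \<notin> \<L>" "B \<notin> \<L>" "A \<union> B \<noteq> A" "A \<union> B \<noteq> B" using disj m(1) by auto
  have AB: "A \<in> dom m'" "B \<in> dom m'" by (simp_all add: m')
  have "\<not> merges m m'"
  proof
    assume "merges m m'"
    then obtain A' B' where "dom m' = insert (A' \<union> B') (dom m - {A', B'})"
      by (rule mergesE)
    then have "dom m' \<subseteq> insert (A' \<union> B') (dom m)" by blast
    then have "A = A' \<union> B'" "B = A' \<union> B'" using AB disj(2,3) by blast+
    with disj show False by simp
  qed
  moreover have "splits m m' \<longleftrightarrow> (\<forall>K \<in> \<L>. m' K = m K) \<and> m' A = Some Minus \<and> m' B = Some Minus"
    (is "_ \<longleftrightarrow> ?P")
  proof
    assume "splits m m'"
    then obtain A' B' where *: "A' \<in> dom m'" "B' \<in> dom m'"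
      "dom m = insert (A' \<union> B') (dom m' - {A', B'})"
      "\<forall>K \<in> dom m' - {A', B'}. m' K = m K"
      "(the (m' A'), the (m' B')) \<in> comult (the (m (A' \<union> B')))"
      by (rule splitsE)
    have "dom m' \<subseteq> insert A' (insert B' (dom m))" unfolding *(3) by blast
    then have "A = A' \<or> A = B'" "B = A' \<or> B = B'" using AB disj(2,3) by blast+
    with disj(1) have AB': "A = A' \<and> B = B' \<or> A = B' \<and> B = A'" by blast
    then have "{A', B'} = {A, B}" by blast
    with *(4) notin have "\<forall>K \<in> \<L>. m' K = m K" unfolding m' by auto
    moreover have "A' \<union> B' = A \<union> B" using AB' by blast
    then have "the (m' A') = Minus" "the (m' B') = Minus" using *(5) m(2) by auto
    then have "m' A' = Some Minus" "m' B' = Some Minus"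
      using domD[OF *(1)] domD[OF *(2)] by auto
    ultimately show ?P using AB' by auto
  next
    assume ?P
    moreover have "dom m' - {A, B} = \<L>" unfolding m' using notin by auto
    ultimately show "splits m m'"
      using m(1,2) AB disj(1) by (intro splitsI[of A m' B]) simp_all
  qed
  ultimately show ?thesis by (simp add: saddle_coeff_def)
qed

text \<open>
  Merges and splits only refer to unions and equality of loops, so they are preserved by a renaming
  of loops that is injective and commutes with unions.
\<close>

lemma saddles_image:
  assumes dom: "dom n = h ` dom m" "dom n' = h ` dom m'" and inj: "inj_on h (dom m \<union> dom m')"
    and n: "\<And>K. K \<in> dom m \<Longrightarrow> n (h K) = m K" and n': "\<And>K. K \<in> dom m' \<Longrightarrow> n' (h K) = m' K"
    and Un: "\<And>A B. h (A \<union> B) = h A \<union> h B"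
    and saddle: "merges m m' \<or> splits m m'"
  shows "merges n n' \<or> splits n n'"
  using saddle
proof
  assume "merges m m'"
  then obtain A B where *: "A \<in> dom m" "B \<in> dom m" "A \<noteq> B"
    "dom m' = insert (A \<union> B) (dom m - {A, B})"
    "\<forall>K \<in> dom m - {A, B}. m' K = m K" "m' (A \<union> B) = mult (the (m A)) (the (m B))"
    by (rule mergesE)
  have diff: "h ` (dom m - {A, B}) = dom n - {h A, h B}"
  proof -
    have "dom m - {A, B} \<subseteq> dom m \<union> dom m'" "{A, B} \<subseteq> dom m \<union> dom m'"
      using *(1,2) by blast+
    from inj_on_image_set_diff[OF inj this] show ?thesis by (simp add: dom)
  qed
  have AB: "A \<union> B \<in> dom m'" by (simp add: *(4))
  have "merges n n'"
  proof (rule mergesI[of "h A" n "h B"])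
    show "h A \<noteq> h B" using inj *(1-3) by (meson UnI1 inj_onD)
    show "h A \<in> dom n" "h B \<in> dom n" using *(1,2) dom by simp_all
    show "dom n' = insert (h A \<union> h B) (dom n - {h A, h B})"
      unfolding diff[symmetric] dom(2) *(4) by (simp add: Un)
    show "n' (h A \<union> h B) = mult (the (n (h A))) (the (n (h B)))"
      using n'[OF AB] by (simp add: Un n[OF *(1)] n[OF *(2)] *(6))
  next
    fix L assume "L \<in> dom n - {h A, h B}"
    then obtain K where "K \<in> dom m - {A, B}" "L = h K" unfolding diff[symmetric] by (rule imageE)
    moreover from this have "K \<in> dom m'" by (simp add: *(4))
    ultimately show "n' L = n L" using *(5) n n' by simp
  qed
  then show ?thesis ..
next
  assume "splits m m'"
  then obtain A B where *: "A \<in> dom m'" "B \<in> dom m'" "A \<noteq> B"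
    "dom m = insert (A \<union> B) (dom m' - {A, B})"
    "\<forall>K \<in> dom m' - {A, B}. m' K = m K" "(the (m' A), the (m' B)) \<in> comult (the (m (A \<union> B)))"
    by (rule splitsE)
  have diff: "h ` (dom m' - {A, B}) = dom n' - {h A, h B}"
  proof -
    have "dom m' - {A, B} \<subseteq> dom m \<union> dom m'" "{A, B} \<subseteq> dom m \<union> dom m'"
      using *(1,2) by blast+
    from inj_on_image_set_diff[OF inj this] show ?thesis by (simp add: dom)
  qed
  have AB: "A \<union> B \<in> dom m" by (simp add: *(4))
  have "splits n n'"
  proof (rule splitsI[of "h A" n' "h B"])
    show "h A \<noteq> h B" using inj *(1-3) by (meson UnI2 inj_onD)
    show "h A \<in> dom n'" "h B \<in> dom n'" using *(1,2) dom by simp_all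
    show "dom n = insert (h A \<union> h B) (dom n' - {h A, h B})"
      unfolding diff[symmetric] dom(1) *(4) by (simp add: Un)
    show "(the (n' (h A)), the (n' (h B))) \<in> comult (the (n (h A \<union> h B)))"
      using *(6) n[OF AB] by (simp add: Un n'[OF *(1)] n'[OF *(2)])
  next
    fix L assume "L \<in> dom n' - {h A, h B}"
    then obtain K where "K \<in> dom m' - {A, B}" "L = h K" unfolding diff[symmetric] by (rule imageE)
    moreover from this have "K \<in> dom m" by (simp add: *(4))
    ultimately show "n' L = n L" using *(5) n n' by simp
  qed
  then show ?thesis ..
qed


section \<open>Straight, bent and split-off strands\<close>

text \<open>
  Fibres are shown to be connected by joining every point to a base point of its fibre.
\<close>

lemma linked_fibre:
  assumes "\<And>x. x \<in> X \<Longrightarrow> (x, base (\<phi> x)) \<in> linked R" "x \<in> X" "y \<in> X" "\<phi> x = \<phi> y"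
  shows "(x, y) \<in> linked R"
  using assms(1)[OF assms(2)] assms(1)[OF assms(3)] assms(4)
  by (metis linked_sym rtrancl_trans)

definition straight :: "nat set \<Rightarrow> nat \<Rightarrow> layer list \<Rightarrow> bool" where
  "straight S w P \<longleftrightarrow> (\<forall>x \<in> set P. \<exists>c t i. x = Cross c t i \<and> i + 1 < w \<and> vertical S c t)"

lemma straight_spans: "straight S w P \<Longrightarrow> spans w P w"
  by (induction P) (auto simp: straight_def)

lemma box_links_straight:
  "straight S w P \<Longrightarrow> (x, y) \<in> box_links S t w P \<Longrightarrow> snd x = snd y"
  by (induction P arbitrary: t) (auto simp: straight_def)

lemma box_points_straight:
  assumes "straight S w P" "x \<in> box_points t w P"
  shows "(x, (t, snd x)) \<in> linked (box_links S t w P) \<and> snd x < w"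
  using assms
proof (induction P arbitrary: t)
  case (Cons y P)
  then obtain c s i where y: "y = Cross c s i" "vertical S c s"
    by (auto simp: straight_def)
  show ?case
  proof (cases "x \<in> box_points (Suc t) w P")
    case True
    then have IH: "(x, (Suc t, snd x)) \<in> linked (box_links S (Suc t) w P)" "snd x < w"
      using Cons.IH Cons.prems(1) by (auto simp: straight_def)
    have "(x, (Suc t, snd x)) \<in> linked (box_links S t w (y # P))"
      by (rule linked_mono[OF IH(1)]) (simp add: y)
    moreover have "((t, snd x), (Suc t, snd x)) \<in> linked (box_links S t w (y # P))"
      using IH(2) by (intro linked_edge) (simp add: y)
    ultimately show ?thesis
      using IH(2) linked_sym by (meson rtrancl_trans)
  next
    case False
    then show ?thesis using Cons.prems(2) by (auto simp: y(1))
  qed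
qed auto

lemma straight_box:
  assumes "spans 0 U w" "spans w W 0" "straight S w P"
  shows "box U P W S w snd"
proof
  show "spans w P w" using assms(3) by (rule straight_spans)
  show "(x, y) \<in> linked (box_links S 0 w P)"
    if "x \<in> box_points 0 w P" "y \<in> box_points 0 w P" "snd x = snd y" for x y
    by (rule linked_fibre[where base = "\<lambda>j. (0, j)" and \<phi> = snd and X = "box_points 0 w P"])
      (use that box_points_straight[OF assms(3)] in auto)
qed (use assms box_links_straight in auto)

text \<open>
  The strand to which strand \<open>j\<close> belongs at a height where strand \<open>i\<close> has been bent or a circle
  lies to its right: two additional strands \<open>i + 1\<close> and \<open>i + 2\<close>
  are present and belong to \<open>v\<close>, which is \<open>i\<close> itself or the number reserved for the circle.
\<close>

definition bend :: "nat \<Rightarrow> nat \<Rightarrow> nat \<Rightarrow> nat" where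
  "bend i v j = (if j \<le> i then j else if j \<le> i + 2 then v else j - 2)"

text \<open>
  The strands on both sides of a cup or a cap keep their numbers after the collapse.
\<close>

lemma bend_skip:
  "bend i i (if j < i then j else j + 2) = j" "bend i v (if j < i + 1 then j else j + 2) = j"
  by (auto simp: bend_def)

lemma bent_points:
  assumes "i + 1 < w"
  shows "box_points 0 w [Cup (i + 1) u', Cap i, Cup i u, Cross c Tau (i + 2), Cap (i + 1)] =
    {0} \<times> {..<w} \<union> {1} \<times> {..<w + 2} \<union> {2} \<times> {..<w} \<union>
    {3} \<times> {..<w + 2} \<union> {4} \<times> {..<w + 2} \<union> {5} \<times> {..<w}"
proof -
  have "min i (w + 2) + (w + 2 - (i + 2)) = w" "min (i + 1) (w + 2) + (w + 2 - (i + 1 + 2)) = w"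
    using assms by auto
  then show ?thesis by (simp add: eval_nat_numeral Un_assoc)
qed

lemma circle_points:
  assumes "i + 1 < w"
  shows "box_points 0 w [Cup (i + 1) u', Cross c Tau (i + 2), Cap (i + 1)] =
    {0} \<times> {..<w} \<union> {1} \<times> {..<w + 2} \<union> {2} \<times> {..<w + 2} \<union> {3} \<times> {..<w}"
proof -
  have "min (i + 1) (w + 2) + (w + 2 - (i + 1 + 2)) = w"
    using assms by auto
  then show ?thesis by (simp add: eval_nat_numeral Un_assoc)
qed

text \<open>
  The diagram after the isotopy that prepares the resolution of a crossing.  Strand \<open>i\<close> runs up
  to the first cap, down to the first cup, up along the smoothed crossing to the last cap, down to
  the second cup and up out of the box; strand \<open>i + 1\<close> passes on the right of it.
\<close>

lemma bent_box:
  assumes "spans 0 U w" "spans w W 0" "i + 1 < w" "c \<notin> S"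
  shows "box U [Cup (i + 1) u', Cap i, Cup i u, Cross c Tau (i + 2), Cap (i + 1)] W S w
    (\<lambda>(t, j). if t \<in> {1, 3, 4} then bend i i j else j)" (is "box _ ?P _ _ _ ?\<phi>")
proof
  have w: "min i (w + 2) + (w + 2 - (i + 2)) = w" "min (i + 1) (w + 2) + (w + 2 - (i + 1 + 2)) = w"
    using assms(3) by auto
  have vert: "vertical S c Tau" using assms(4) by (simp add: vertical_def)
  define B where "B = box_links S 0 w ?P"
  have links: "B = links S 0 w (Cup (i + 1) u') \<union> links S 1 (w + 2) (Cap i) \<union>
      links S 2 w (Cup i u) \<union> links S 3 (w + 2) (Cross c Tau (i + 2)) \<union> links S 4 (w + 2) (Cap (i + 1))"
    unfolding B_def using w by (simp add: eval_nat_numeral Un_assoc del: links.simps)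
  note points = bent_points[OF assms(3)]
  show "spans w ?P w" using assms(3) w by auto
  show "?\<phi> x = ?\<phi> y" if "(x, y) \<in> box_links S 0 w ?P" for x y
    using that[folded B_def] unfolding links by (auto simp: bend_def vert split: if_splits)
  let ?L = "linked B"
  have trans: "(x, z) \<in> ?L" if "(x, y) \<in> ?L" "(y, z) \<in> ?L" for x y z
    using that by (rule rtrancl_trans)
  have edge: "(x, y) \<in> ?L \<and> (y, x) \<in> ?L" if "(x, y) \<in> B" for x y
    using conjI[OF linked_edge[OF that] linked_sym[OF linked_edge[OF that]]] .
  \<comment> \<open>The strands are followed from one height to the next, always back to the bottom of the box.\<close>
  have l1: "((1, j), (0, bend i i j)) \<in> ?L" if "j < w + 2" for j
  proof -
    have out: "((1, if j < i + 1 then j else j + 2), (0, j)) \<in> ?L" if "j < w" for j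
      using that edge unfolding links by simp
    have 1: "((1, i), (0, i)) \<in> ?L" using out[of i] assms(3) by simp
    have 2: "((1, i + 1), (1, i)) \<in> ?L" using edge unfolding links by simp
    have 3: "((1, i + 2), (1, i + 1)) \<in> ?L" using edge unfolding links by simp
    consider "j \<le> i" | "j = i + 1" | "j = i + 2" | "i + 3 \<le> j" by linarith
    then show ?thesis
    proof cases
      case 1 then show ?thesis using out[of j] assms(3) by (simp add: bend_def)
    next
      case 2 then show ?thesis using trans[OF \<open>((1, i + 1), (1, i)) \<in> ?L\<close> 1] by (simp add: bend_def)
    next
      case 3 then show ?thesis using trans[OF \<open>((1, i + 2), (1, i + 1)) \<in> ?L\<close> trans[OF 2 1]] by (simp add: bend_def)
    next
      case 4
      then obtain k where "j = i + 3 + k" using le_Suc_ex by blast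
      then show ?thesis using out[of "i + 1 + k"] that by (simp add: bend_def eval_nat_numeral)
    qed
  qed
  have l2: "((2, j), (0, j)) \<in> ?L" if "j < w" for j
  proof -
    have "((2, j), (1, if j < i then j else j + 2)) \<in> ?L"
      using that edge unfolding links by simp
    moreover have "(if j < i then j else j + 2) < w + 2" using that by simp
    ultimately show ?thesis using trans[OF _ l1] bend_skip(1) by metis
  qed
  have l3_out: "((3, j), (0, bend i i j)) \<in> ?L" if "j < w + 2" "j < i \<or> i + 2 \<le> j" for j
  proof -
    have out: "((3, if j < i then j else j + 2), (2, j)) \<in> ?L" if "j < w" for j
      using that edge unfolding links by simp
    show ?thesis
    proof (cases "j < i")
      case True
      then show ?thesis using trans[OF out[of j] l2[of j]] assms(3) by (simp add: bend_def)
    next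
      case False
      then obtain k where "j = i + 2 + k" using \<open>j < i \<or> i + 2 \<le> j\<close> le_Suc_ex by blast
      then show ?thesis using trans[OF out[of "i + k"] l2[of "i + k"]] \<open>j < w + 2\<close>
        by (cases k) (simp_all add: bend_def eval_nat_numeral)
    qed
  qed
  have up3: "((3, j), (4, j)) \<in> ?L \<and> ((4, j), (3, j)) \<in> ?L" if "j < w + 2" for j
    using that edge unfolding links by (simp add: vert)
  \<comment> \<open>At height 3 the strands i and i + 1 are reached only from above, over the last cap.\<close>
  have "((4, i + 1), (4, i + 2)) \<in> ?L" using edge unfolding links by simp
  then have l3a: "((3, i + 1), (0, i)) \<in> ?L"
    using trans[OF conjunct1[OF up3[of "i + 1"]]
        trans[OF _ trans[OF conjunct2[OF up3[of "i + 2"]] l3_out[of "i + 2"]]]] assms(3)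
    by (simp add: bend_def)
  have "((3, i), (3, i + 1)) \<in> ?L" using edge unfolding links by simp
  from trans[OF this l3a] have l3b: "((3, i), (0, i)) \<in> ?L" .
  have l3: "((3, j), (0, bend i i j)) \<in> ?L" if "j < w + 2" for j
  proof -
    consider "j < i \<or> i + 2 \<le> j" | "j = i" | "j = i + 1" by linarith
    then show ?thesis by cases (use l3_out[of j] l3a l3b that in \<open>auto simp: bend_def\<close>)
  qed
  have l4: "((4, j), (0, bend i i j)) \<in> ?L" if "j < w + 2" for j
    using trans[OF conjunct2[OF up3] l3] that by simp
  have l5: "((5, j), (0, j)) \<in> ?L" if "j < w" for j
  proof -
    have "((5, j), (4, if j < i + 1 then j else j + 2)) \<in> ?L"
      using that edge unfolding links by simp
    moreover have "(if j < i + 1 then j else j + 2) < w + 2" using that by simp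
    ultimately show ?thesis using trans[OF _ l4] bend_skip(2) by metis
  qed
  show "(x, y) \<in> linked (box_links S 0 w ?P)"
    if "x \<in> box_points 0 w ?P" "y \<in> box_points 0 w ?P" "?\<phi> x = ?\<phi> y" for x y
    unfolding B_def[symmetric]
  proof (rule linked_fibre[where base = "\<lambda>j. (0, j)", OF _ that])
    fix x assume "x \<in> box_points 0 w ?P"
    then show "(x, (0, ?\<phi> x)) \<in> ?L" unfolding points using l1 l2 l3 l4 l5 by auto
  qed
qed (use assms in auto)

text \<open>
  The diagram after the saddle.  The strands \<open>i + 1\<close> and \<open>i + 2\<close> at the two inner heights close up to
  a circle, which is sent to the number \<open>w\<close>, one more than the last strand.
\<close>

lemma circle_box:
  assumes "spans 0 U w" "spans w W 0" "i + 1 < w" "c \<notin> S"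
  shows "box U [Cup (i + 1) u', Cross c Tau (i + 2), Cap (i + 1)] W S w
    (\<lambda>(t, j). if t \<in> {1, 2} then bend i w j else j)" (is "box _ ?P _ _ _ ?\<phi>")
proof
  have w: "min (i + 1) (w + 2) + (w + 2 - (i + 1 + 2)) = w"
    using assms(3) by auto
  have vert: "vertical S c Tau" using assms(4) by (simp add: vertical_def)
  define B where "B = box_links S 0 w ?P"
  have links: "B = links S 0 w (Cup (i + 1) u') \<union>
      links S 1 (w + 2) (Cross c Tau (i + 2)) \<union> links S 2 (w + 2) (Cap (i + 1))"
    unfolding B_def using w by (simp add: eval_nat_numeral Un_assoc del: links.simps)
  note points = circle_points[OF assms(3)]
  show "spans w ?P w" using assms(3) w by auto
  show "?\<phi> x = ?\<phi> y" if "(x, y) \<in> box_links S 0 w ?P" for x y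
    using that[folded B_def] unfolding links by (auto simp: bend_def vert split: if_splits)
  let ?L = "linked B"
  \<comment> \<open>The circle does not reach the bottom; its base point is its left strand at height 1.\<close>
  let ?b = "\<lambda>j. if j = w then (1, i + 1) else (0, j)"
  have trans: "(x, z) \<in> ?L" if "(x, y) \<in> ?L" "(y, z) \<in> ?L" for x y z
    using that by (rule rtrancl_trans)
  have edge: "(x, y) \<in> ?L \<and> (y, x) \<in> ?L" if "(x, y) \<in> B" for x y
    using conjI[OF linked_edge[OF that] linked_sym[OF linked_edge[OF that]]] .
  have l1: "((1, j), ?b (bend i w j)) \<in> ?L" if "j < w + 2" for j
  proof -
    have out: "((1, if j < i + 1 then j else j + 2), (0, j)) \<in> ?L" if "j < w" for j
      using that edge unfolding links by simp
    have circle: "((1, i + 2), (1, i + 1)) \<in> ?L" using edge unfolding links by simp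
    consider "j \<le> i" | "j = i + 1" | "j = i + 2" | "i + 3 \<le> j" by linarith
    then show ?thesis
    proof cases
      case 1 then show ?thesis using out[of j] assms(3) by (simp add: bend_def)
    next
      case 4
      then obtain k where "j = i + 3 + k" using le_Suc_ex by blast
      then show ?thesis using out[of "i + 1 + k"] that by (simp add: bend_def eval_nat_numeral)
    qed (use circle in \<open>simp_all add: bend_def\<close>)
  qed
  have l2: "((2, j), ?b (bend i w j)) \<in> ?L" if "j < w + 2" for j
  proof -
    have "((2, j), (1, j)) \<in> ?L" using that edge unfolding links by (simp add: vert)
    from trans[OF this l1] that show ?thesis by blast
  qed
  have l3: "((3, j), (0, j)) \<in> ?L" if "j < w" for j
  proof -
    have "((3, j), (2, if j < i + 1 then j else j + 2)) \<in> ?L"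
      using that edge unfolding links by simp
    moreover have "(if j < i + 1 then j else j + 2) < w + 2" using that by simp
    ultimately have "((3, j), ?b j) \<in> ?L" using trans[OF _ l2] bend_skip(2) by metis
    with that show ?thesis by simp
  qed
  show "(x, y) \<in> linked (box_links S 0 w ?P)"
    if "x \<in> box_points 0 w ?P" "y \<in> box_points 0 w ?P" "?\<phi> x = ?\<phi> y" for x y
    unfolding B_def[symmetric]
  proof (rule linked_fibre[where base = ?b, OF _ that])
    fix x assume "x \<in> box_points 0 w ?P"
    then consider j where "x = (0, j)" "j < w" | j where "x = (1, j)" "j < w + 2"
      | j where "x = (2, j)" "j < w + 2" | j where "x = (3, j)" "j < w"
      unfolding points by blast
    then show "(x, ?b (?\<phi> x)) \<in> ?L"
    proof cases
      case (2 j) then show ?thesis using l1[of j] by (simp split: if_splits)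
    next
      case (3 j) then show ?thesis using l2[of j] by (simp split: if_splits)
    next
      case (4 j) then show ?thesis using l3[of j] by simp
    qed simp
  qed
qed (use assms in auto)


section \<open>Elementary chain maps on pulled back markings\<close>

context box
begin

text \<open>
  If \<open>\<phi>\<close> takes no number beyond the strands, then the box contains no circle.
\<close>

lemma circle_free:
  assumes "\<And>x. x \<in> box_points 0 w P \<Longrightarrow> \<phi> x < w" "K \<in> loops (U @ P @ W) S"
  shows "r ` K \<in> loops (U @ W) S"
proof -
  obtain x where x: "x \<in> K" using loops_nonempty[OF assms(2)] by blast
  then have px: "x \<in> points (U @ P @ W)" using loops_subset[OF spans_E assms(2)] by blast
  have "r x \<in> points (U @ W)"
  proof (rule level_cases[of x])
    fix l j assume "x = (l, j)" "l < length U"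
    then show ?thesis using px r_low points_low by simp
  next
    fix l j assume "x = (length U + l, j)" "l \<le> length P"
    moreover from this have "\<phi> (l, j) < w" using px assms(1) points_mid by simp
    ultimately show ?thesis
      using r_mid fold_spans[OF below] by (simp add: points_def width_fold)
  next
    fix l j assume "x = (l + length P, j)" "length U < l"
    then show ?thesis using px r_high points_high by simp
  qed
  then show ?thesis using image_loop_iff[OF assms(2) x] by simp
qed

lemma trace_nonempty:
  assumes "K \<in> loops (U @ P @ W) S" "r ` K \<in> loops (U @ W) S"
  shows "trace (length U) (length P) K \<noteq> {}"
  using trace_box[OF assms] trace_0_nonempty[OF loops_nonempty[OF assms(2)]] by simp

lemma outer_eq_pull_iff:
  assumes "dom m = loops (U @ W) S" "dom m' = loops (U @ W) S"
  shows "outer (length U) 0 m' = outer (length U) (length P) (pull (U @ P @ W) S r m) \<longleftrightarrow> m' = m"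
  unfolding outer_pull[OF assms(1)]
proof
  assume "outer (length U) 0 m' = outer (length U) 0 m"
  then show "m' = m"
    by (rule outer_determines[OF assms(2,1), rotated]) (simp add: trace_0_nonempty loops_nonempty)
qed simp

text \<open>
  Without circles in the box, a marking is determined by what is seen of it outside.
\<close>

lemma pull_eq_outer_iff:
  assumes "\<And>x. x \<in> box_points 0 w P \<Longrightarrow> \<phi> x < w"
    and "dom m = loops (U @ W) S" "dom m' = loops (U @ P @ W) S"
  shows "outer (length U) (length P) m' = outer (length U) 0 m \<longleftrightarrow> m' = pull (U @ P @ W) S r m"
  unfolding outer_pull[OF assms(2), symmetric]
proof
  assume "outer (length U) (length P) m' =
    outer (length U) (length P) (pull (U @ P @ W) S r m)"
  then show "m' = pull (U @ P @ W) S r m"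
    by (rule outer_determines[OF assms(3) dom_pull, rotated])
      (simp add: trace_nonempty circle_free[OF assms(1)])
qed simp

lemma death_pull:
  assumes "dom m = loops (U @ W) S"
  shows "death (length U) (length P) (pull (U @ P @ W) S r m)"
  unfolding death_def
proof (intro ballI impI)
  fix K assume K: "K \<in> dom (pull (U @ P @ W) S r m)" "trace (length U) (length P) K = {}"
  then have "K \<in> loops (U @ P @ W) S" "r ` K \<notin> dom m" using trace_nonempty assms by auto
  then show "pull (U @ P @ W) S r m K = Some Minus" by (rule pull_outside)
qed

lemma RI_map_ket:
  assumes "dom m = loops (U @ W) S" "c \<notin> S" "S \<subseteq> crossings (U @ P @ W)" "S \<subseteq> crossings (U @ W)"
  shows "RI_map U P c W (ket (S, pull (U @ P @ W) S r m)) = ket (S, m)"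
proof -
  have "RI_map U P c W (ket (S, pull (U @ P @ W) S r m)) = scale 1 (ket (S, m))"
    unfolding RI_map_def
    using assms death_pull[OF assms(1)] outer_eq_pull_iff[OF assms(1)]
    by (intro lin_ket_eq) (auto simp: estates_def)
  then show ?thesis by simp
qed

text \<open>
  The state has exactly the negative one of the two crossings 1-smoothed, so only the first clause
  of \<open>RII_map\<close> applies.
\<close>

lemma RII_map_ket:
  assumes m: "dom m = loops (U @ W) S" and T: "loops (U @ W) (S - {b}) = loops (U @ W) S"
    and "a \<notin> S" "b \<in> S" "S \<subseteq> crossings (U @ P @ W)" "S - {b} \<subseteq> crossings (U @ W)"
  shows "RII_map U P a b W (ket (S, pull (U @ P @ W) S r m)) =
    scale ((-1) ^ card {x \<in> S. b < x}) (ket (S - {b}, m))"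
  unfolding RII_map_def
proof (rule lin_ket_eq)
  fix \<beta> assume \<beta>: "\<beta> \<in> estates (U @ W)"
  obtain S' m' where \<beta>_eq: "\<beta> = (S', m')" by (cases \<beta>)
  show "(case (S, pull (U @ P @ W) S r m) of (S, m) \<Rightarrow> \<lambda>(S', m').
      if a \<notin> S \<and> b \<in> S \<and> S' = S - {b} then
        (-1) ^ card {x \<in> S. b < x} *
        of_bool (outer (length U) 0 m' = outer (length U) (length P) m)
      else if a \<in> S \<and> b \<notin> S \<and> S' = S - {a} then
        - ((-1) ^ card {x \<in> S. a < x}) * of_bool (death (length U) (length P) m) *
        saddle_coeff (outer (length U) (length P) m) (outer (length U) 0 m')
      else 0) \<beta> =
    (-1) ^ card {x \<in> S. b < x} * of_bool (\<beta> = (S - {b}, m))"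
  proof (cases "S' = S - {b}")
    case True
    then have "dom m' = loops (U @ W) S" using \<beta> T by (simp add: \<beta>_eq estates_def)
    from outer_eq_pull_iff[OF m this] True show ?thesis
      using assms(3,4) by (simp add: \<beta>_eq)
  qed (use assms(3) in \<open>simp add: \<beta>_eq\<close>)
qed (use assms in \<open>simp_all add: estates_def\<close>)

end

lemma isotopy_map_ket:
  assumes "box U P W S w \<phi>" "box U Q W S w \<psi>"
    and "\<And>x. x \<in> box_points 0 w Q \<Longrightarrow> \<psi> x < w"
    and m: "dom m = loops (U @ W) S" and "S \<subseteq> crossings (U @ P @ W)" "S \<subseteq> crossings (U @ Q @ W)"
  shows "isotopy_map U P Q W (ket (S, pull (U @ P @ W) S (retract (length U) (length P) \<phi>) m)) =
    ket (S, pull (U @ Q @ W) S (retract (length U) (length Q) \<psi>) m)"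
proof -
  interpret P: box U P W S w \<phi> by fact
  interpret Q: box U Q W S w \<psi> by fact
  have "isotopy_map U P Q W (ket (S, pull (U @ P @ W) S (retract (length U) (length P) \<phi>) m)) =
    scale 1 (ket (S, pull (U @ Q @ W) S (retract (length U) (length Q) \<psi>) m))"
    unfolding isotopy_map_def
    using assms(5,6) P.outer_pull[OF m] Q.pull_eq_outer_iff[OF assms(3) m]
    by (intro lin_ket_eq) (auto simp: estates_def)
  then show ?thesis by simp
qed

text \<open>
  A point off the diagram is isolated.
\<close>

lemma connected_outside:
  assumes "(x, y) \<in> connected_in D S" "spans 0 D w" "x \<notin> points D"
  shows "y = x"
  using assms(1) unfolding connected_in_box
proof (induction rule: rtrancl_induct)
  case (step y z)
  then show ?case using box_links_points[OF assms(2)] assms(3) unfolding points_box by blast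
qed simp

text \<open>
  The saddle from the bent strand (\<open>P\<^sub>1\<close>) to the straight strand with a circle (\<open>P\<^sub>2\<close>).  The saddle map
  compares the two diagrams outside of the two layers in the middle of \<open>P\<^sub>1\<close>, where the circle
  is visible.  Both diagrams collapse to \<open>U @ W\<close>: each loop \<open>L\<close> of \<open>U @ W\<close> has a preimage \<open>g1 L\<close> and
  a preimage \<open>g2 L\<close>, and their traces agree except for the loop \<open>L0\<close> of strand \<open>i\<close>, whose trace is the
  union of the traces of \<open>g2 L0\<close> and the circle \<open>C\<close>.  So the saddle splits \<open>C\<close> off a loop marked
  \<open>v\<^sub>-\<close>, and only one marking is reached.
\<close>

lemma saddle_coeff_bent:
  fixes P\<^sub>1 P\<^sub>2 :: "layer list" and \<phi>\<^sub>1 \<phi>\<^sub>2 :: "point \<Rightarrow> nat"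
  assumes box1: "box U P\<^sub>1 W S w \<phi>\<^sub>1" and box2: "box U P\<^sub>2 W S w \<phi>\<^sub>2"
    and len: "length P\<^sub>1 = 5" "length P\<^sub>2 = 3" and iw: "i + 1 < w"
    and \<phi>: "\<phi>\<^sub>1 = (\<lambda>(t, j). if t \<in> {1, 3, 4} then bend i i j else j)"
      "\<phi>\<^sub>2 = (\<lambda>(t, j). if t \<in> {1, 2} then bend i w j else j)"
    and lev1: "\<And>t j. (t, j) \<in> box_points 0 w P\<^sub>1 \<longleftrightarrow> t \<le> 5 \<and> j < (if t \<in> {1, 3, 4} then w + 2 else w)"
    and lev2: "\<And>t j. (t, j) \<in> box_points 0 w P\<^sub>2 \<longleftrightarrow> t \<le> 3 \<and> j < (if t \<in> {1, 2} then w + 2 else w)"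
    and m: "dom m = loops (U @ W) S" "m (loop_of (U @ W) S (length U, i)) = Some Minus"
    and m': "dom m' = loops (U @ P\<^sub>2 @ W) S"
  shows "saddle_coeff (outer (length U + 1) 2 (pull (U @ P\<^sub>1 @ W) S (retract (length U) 5 \<phi>\<^sub>1) m))
      (outer (length U + 1) 0 m') =
    of_bool (m' = pull (U @ P\<^sub>2 @ W) S (retract (length U) 3 \<phi>\<^sub>2) m)"
proof -
  interpret b1: box U P\<^sub>1 W S w \<phi>\<^sub>1 by fact
  interpret b2: box U P\<^sub>2 W S w \<phi>\<^sub>2 by fact
  define a where "a = length U"
  define F where "F = U @ W"
  define r1 where "r1 = b1.r"
  define r2 where "r2 = b2.r"
  define E1 where "E1 = points (U @ P\<^sub>1 @ W)"
  define E2 where "E2 = points (U @ P\<^sub>2 @ W)"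
  define g1 where "g1 = (\<lambda>L. {x \<in> E1. r1 x \<in> L})"
  define g2 where "g2 = (\<lambda>L. {x \<in> E2. r2 x \<in> L})"
  define C where "C = {x \<in> E2. r2 x = (a, w)}"
  define L0 where "L0 = loop_of F S (a, i)"
  define T1 where "T1 = trace (a + 1) 2"
  define T2 where "T2 = trace (a + 1) 0"
  have r1: "l \<le> a \<Longrightarrow> r1 (l, j) = (l, j)" "t \<le> 5 \<Longrightarrow> r1 (a + t, j) = (a, \<phi>\<^sub>1 (t, j))"
    "a \<le> l \<Longrightarrow> r1 (l + 5, j) = (l, j)" for l t j
    using b1.r_low b1.r_mid b1.r_high by (simp_all add: r1_def a_def len)
  have r2: "l \<le> a \<Longrightarrow> r2 (l, j) = (l, j)" "t \<le> 3 \<Longrightarrow> r2 (a + t, j) = (a, \<phi>\<^sub>2 (t, j))"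
    "a \<le> l \<Longrightarrow> r2 (l + 3, j) = (l, j)" for l t j
    using b2.r_low b2.r_mid b2.r_high by (simp_all add: r2_def a_def len)
  have E1: "l \<le> a \<Longrightarrow> (l, j) \<in> E1 \<longleftrightarrow> (l, j) \<in> points F"
    "t \<le> 5 \<Longrightarrow> (a + t, j) \<in> E1 \<longleftrightarrow> j < (if t \<in> {1, 3, 4} then w + 2 else w)"
    "a \<le> l \<Longrightarrow> (l + 5, j) \<in> E1 \<longleftrightarrow> (l, j) \<in> points F" for l t j
    using b1.points_low b1.points_mid b1.points_high lev1 by (simp_all add: E1_def a_def F_def len)
  have E2: "l \<le> a \<Longrightarrow> (l, j) \<in> E2 \<longleftrightarrow> (l, j) \<in> points F"
    "t \<le> 3 \<Longrightarrow> (a + t, j) \<in> E2 \<longleftrightarrow> j < (if t \<in> {1, 2} then w + 2 else w)"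
    "a \<le> l \<Longrightarrow> (l + 3, j) \<in> E2 \<longleftrightarrow> (l, j) \<in> points F" for l t j
    using b2.points_low b2.points_mid b2.points_high lev2 by (simp_all add: E2_def a_def F_def len)
  have aF: "(a, j) \<in> points F \<longleftrightarrow> j < w" for j
    using fold_spans[OF b1.below] by (simp add: points_def width_fold a_def F_def)
  have subF: "L \<subseteq> points F" if "L \<in> loops F S" for L
    using loops_subset[OF b1.spans_F] that by (simp add: F_def)

  have loops1: "loops (U @ P\<^sub>1 @ W) S = g1 ` loops F S"
  proof (intro equalityI subsetI)
    fix K assume K: "K \<in> loops (U @ P\<^sub>1 @ W) S"
    have "\<phi>\<^sub>1 x < w" if "x \<in> box_points 0 w P\<^sub>1" for x
      using that lev1 iw by (cases x) (auto simp: \<phi> bend_def split: if_splits)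
    then have "r1 ` K \<in> loops F S"
      using b1.circle_free[OF _ K] by (simp add: r1_def F_def)
    moreover have "K = g1 (r1 ` K)" using b1.saturated[OF K] by (simp add: g1_def E1_def r1_def)
    ultimately show "K \<in> g1 ` loops F S" by blast
  next
    fix K assume "K \<in> g1 ` loops F S"
    then show "K \<in> loops (U @ P\<^sub>1 @ W) S"
      using b1.preimage_loop(1) by (auto simp: g1_def E1_def r1_def F_def)
  qed
  have aw: "(a, w) \<notin> points F" by (simp add: aF)
  have loop_C: "loop_of (U @ P\<^sub>2 @ W) S x = C" if "x \<in> C" for x
  proof -
    have x: "x \<in> points (U @ P\<^sub>2 @ W)" "b2.r x = (a, w)"
      using that by (auto simp: C_def E2_def r2_def)
    have "((a, w), y) \<in> connected_in F S \<longleftrightarrow> y = (a, w)" for y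
    proof
      show "((a, w), y) \<in> connected_in F S \<Longrightarrow> y = (a, w)"
        using connected_outside[OF _ b1.spans_F] aw unfolding F_def by blast
    qed (simp add: connected_in_box)
    then show ?thesis
      unfolding b2.loop_of_box[OF x(1)] x(2) by (simp add: C_def E2_def r2_def F_def)
  qed
  have C_ne: "(a + 1, i + 1) \<in> C"
    using E2(2)[of 1 "i + 1"] r2(2)[of 1 "i + 1"] iw by (simp add: C_def \<phi> bend_def)
  have C_loop: "C \<in> loops (U @ P\<^sub>2 @ W) S"
    using loop_of_in_loops[of "(a + 1, i + 1)" "U @ P\<^sub>2 @ W" S] loop_C[OF C_ne] C_ne
    by (simp add: C_def E2_def)
  have g2_loop: "g2 L \<in> loops (U @ P\<^sub>2 @ W) S" "r2 ` g2 L = L" if "L \<in> loops F S" for L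
    using b2.preimage_loop[of L] that by (simp_all add: g2_def E2_def r2_def F_def)
  have g1_loop: "g1 L \<in> loops (U @ P\<^sub>1 @ W) S" "r1 ` g1 L = L" if "L \<in> loops F S" for L
    using b1.preimage_loop[of L] that by (simp_all add: g1_def E1_def r1_def F_def)
  have loops2: "loops (U @ P\<^sub>2 @ W) S = insert C (g2 ` loops F S)"
  proof (intro equalityI subsetI)
    fix K assume K: "K \<in> loops (U @ P\<^sub>2 @ W) S"
    show "K \<in> insert C (g2 ` loops F S)"
    proof (cases "r2 ` K \<in> loops F S")
      case True
      moreover have "K = g2 (r2 ` K)" using b2.saturated[OF K] by (simp add: g2_def E2_def r2_def)
      ultimately show ?thesis by blast
    next
      case False
      obtain x where x: "x \<in> K" using loops_nonempty[OF K] by blast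
      then have xE: "x \<in> E2" using loops_subset[OF b2.spans_E K] by (auto simp: E2_def)
      have "r2 x \<notin> points F" using b2.image_loop_iff[OF K x] False by (simp add: r2_def F_def)
      then have "r2 x = (a, w)"
      proof (rule_tac b2.level_cases[of x])
        fix l j assume "x = (l, j)" "l < length U"
        then show ?thesis using \<open>r2 x \<notin> points F\<close> xE r2(1) E2(1) by (simp add: a_def)
      next
        fix t j assume t: "x = (length U + t, j)" "t \<le> length P\<^sub>2"
        then have "r2 x = (a, \<phi>\<^sub>2 (t, j))" "j < (if t \<in> {1, 2} then w + 2 else w)"
          using xE r2(2) E2(2) by (simp_all add: a_def len)
        then show ?thesis
          using \<open>r2 x \<notin> points F\<close> aF iw by (auto simp: \<phi> bend_def split: if_splits)
      next
        fix l j assume "x = (l + length P\<^sub>2, j)" "length U < l"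
        then show ?thesis using \<open>r2 x \<notin> points F\<close> xE r2(3) E2(3) by (simp add: a_def len)
      qed
      then have "x \<in> C" using xE by (simp add: C_def)
      from loop_C[OF this] show ?thesis using loops_eq_loop_of[OF K x] by simp
    qed
  next
    fix K assume "K \<in> insert C (g2 ` loops F S)"
    then show "K \<in> loops (U @ P\<^sub>2 @ W) S" using C_loop g2_loop(1) by auto
  qed
  have trace12: "T1 (g1 L) = T2 (g2 L \<union> (if (a, i) \<in> L then C else {}))" if "L \<in> loops F S" for L
    unfolding T1_def T2_def
  proof (rule trace_eqI)
    have awL: "(a, w) \<notin> L" using subF[OF that] aw by blast
    \<comment> \<open>The two collapses differ in the two additional strands only, which go to strand i or to the circle.\<close>
    have bend: "(a, bend i i j) \<in> L \<longleftrightarrow> (a, bend i w j) \<in> L \<or> (a, i) \<in> L \<and> bend i w j = w"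
      if "j < w + 2" for j
      using that awL iw by (auto simp: bend_def)
    \<comment> \<open>The heights 1, 3, 4 inside P1 are seen from outside as the heights 1, 1, 2 of P2.\<close>
    have mid: "(a + t, j) \<in> g1 L \<longleftrightarrow> (a + t', j) \<in> g2 L \<union> (if (a, i) \<in> L then C else {})"
      if "t \<in> {1, 3, 4}" "t' \<in> {1, 2}" for t t' j
    proof -
      have "t \<le> 5" "t' \<le> 3" using that by auto
      then show ?thesis
        using that bend[of j] r1(2)[of t j] r2(2)[of t' j] E1(2)[of t j] E2(2)[of t' j]
        by (simp add: g1_def g2_def C_def \<phi>) blast
    qed
    {
      fix l j assume "l \<le> a + 1"
      then consider "l \<le> a" | "l = a + 1" by linarith
      then show "(l, j) \<in> g1 L \<longleftrightarrow> (l, j) \<in> g2 L \<union> (if (a, i) \<in> L then C else {})"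
      proof cases
        case 1
        then show ?thesis using E1(1) E2(1) r1(1) r2(1) aw by (auto simp: g1_def g2_def C_def)
      next
        case 2
        then show ?thesis using mid[of 1 1 j] by simp
      qed
    next
      fix h j :: nat
      consider "h = 0" | "h = 1" | k where "h = 2 + k"
        using le_Suc_ex[of 2 h] by (metis less_2_cases One_nat_def linorder_not_le)
      then show "(a + 1 + 2 + h, j) \<in> g1 L \<longleftrightarrow>
        (a + 1 + 0 + h, j) \<in> g2 L \<union> (if (a, i) \<in> L then C else {})"
      proof cases
        case 1
        then show ?thesis using mid[of 3 1 j] by (simp add: numeral_eq_Suc)
      next
        case 2
        then show ?thesis using mid[of 4 2 j] by (simp add: numeral_eq_Suc)
      next
        case 3
        have "a + 1 + 2 + h = (a + k) + 5" "a + 1 + 0 + h = (a + k) + 3" using 3 by simp_all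
        then show ?thesis unfolding g1_def g2_def C_def using E1(3)[of "a + k" j] E2(3)[of "a + k" j] r1(3)[of "a + k" j]
            r2(3)[of "a + k" j] aw by (simp only:) auto
      qed
    }
  qed
  have T2_ne: "T2 K \<noteq> {}" if "K \<in> loops (U @ P\<^sub>2 @ W) S" for K
    using trace_0_nonempty[OF loops_nonempty[OF that]] by (simp add: T2_def)
  have T1_ne: "T1 K \<noteq> {}" if "K \<in> loops (U @ P\<^sub>1 @ W) S" for K
  proof -
    from that obtain L where L: "L \<in> loops F S" "K = g1 L" unfolding loops1 by auto
    then have "T2 (g2 L) \<subseteq> T1 K" using trace12[OF L(1)] by (simp add: T2_def trace_Un)
    then show ?thesis using T2_ne[OF g2_loop(1)[OF L(1)]] by blast
  qed
  let ?n = "outer (a + 1) 2 (pull (U @ P\<^sub>1 @ W) S r1 m)" and ?n' = "outer (a + 1) 0 m'"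
  let ?\<L> = "(\<lambda>L. T2 (g2 L)) ` (loops F S - {L0})"
  have L0: "L0 \<in> loops F S" "(a, i) \<in> L0"
    using iw aF[of i] by (simp_all add: L0_def loop_of_in_loops loop_of_self)
  have mem_L0: "(a, i) \<in> L \<longleftrightarrow> L = L0" if "L \<in> loops F S" for L
    using loops_eq_loop_of[OF that] L0(2) by (auto simp: L0_def)
  have T1_L0: "T1 (g1 L0) = T2 (g2 L0) \<union> T2 C"
    using trace12[OF L0(1)] L0(2) by (simp add: T2_def trace_Un)
  have T1_L: "T1 (g1 L) = T2 (g2 L)" if "L \<in> loops F S" "L \<noteq> L0" for L
    using trace12[OF that(1)] mem_L0[OF that(1)] that(2) by simp
  \<comment> \<open>T2 keeps all points, so it separates loops.\<close>
  have T2_inj: "K = L" if "K \<in> loops (U @ P\<^sub>2 @ W) S" "L \<in> loops (U @ P\<^sub>2 @ W) S"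
    "T \<in> T2 K" "T \<in> T2 L" for K L T
    using trace_disjoint[of T "a + 1" 0 K L] loops_disjoint[OF that(1,2)] that(3,4)
    unfolding T2_def by blast
  have g2_inj: "L = L'" if "L \<in> loops F S" "L' \<in> loops F S" "g2 L = g2 L'" for L L'
    using g2_loop(2)[OF that(1)] g2_loop(2)[OF that(2)] that(3) by metis
  have C_notin: "g2 L \<noteq> C" if "L \<in> loops F S" for L
  proof
    assume "g2 L = C"
    then have "(a + 1, i + 1) \<in> g2 L" using C_ne by simp
    then have "(a, w) \<in> L" using C_ne by (simp add: g2_def C_def)
    then show False using subF[OF that] aw by blast
  qed
  have n: "?n (T1 (g1 L)) = m L" if "L \<in> loops F S" for L
    using outer_trace[OF dom_pull, of "g1 L"] T1_ne g1_loop[OF that] pull_eq[OF g1_loop(1)[OF that]]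
      that m(1) by (simp add: T1_def F_def)
  have n_L: "?n (T2 (g2 L)) = m L" if "L \<in> loops F S" "L \<noteq> L0" for L
    using n[OF that(1)] unfolding T1_L[OF that] .
  have n': "?n' (T2 K) = m' K" if "K \<in> loops (U @ P\<^sub>2 @ W) S" for K
    using outer_trace[OF m' that] T2_ne[OF that] by (simp add: T2_def)
  have dom_n: "dom ?n = insert (T2 (g2 L0) \<union> T2 C) ?\<L>"
  proof -
    have "dom ?n = T1 ` loops (U @ P\<^sub>1 @ W) S"
      unfolding dom_outer[OF dom_pull] T1_def[symmetric] using T1_ne by blast
    also have "\<dots> = (\<lambda>L. T1 (g1 L)) ` insert L0 (loops F S - {L0})"
      unfolding loops1 using L0(1) by (simp add: image_image insert_absorb)
    also have "\<dots> = insert (T2 (g2 L0) \<union> T2 C) ?\<L>"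
    proof -
      have "(\<lambda>L. T1 (g1 L)) ` (loops F S - {L0}) = ?\<L>" using T1_L by (intro image_cong) auto
      then show ?thesis unfolding image_insert T1_L0 by simp
    qed
    finally show ?thesis .
  qed
  have dom_n': "dom ?n' = insert (T2 (g2 L0)) (insert (T2 C) ?\<L>)"
  proof -
    have "dom ?n' = T2 ` loops (U @ P\<^sub>2 @ W) S"
      unfolding dom_outer[OF m'] T2_def[symmetric] using T2_ne by blast
    also have "\<dots> = insert (T2 C) ((\<lambda>L. T2 (g2 L)) ` insert L0 (loops F S - {L0}))"
      unfolding loops2 using L0(1) by (simp add: image_image insert_absorb)
    finally show ?thesis unfolding image_insert by (simp only: insert_commute)
  qed
  obtain A0 B0 where AB0: "A0 \<in> T2 (g2 L0)" "B0 \<in> T2 C"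
    using T2_ne[OF g2_loop(1)[OF L0(1)]] T2_ne[OF C_loop] by blast
  have notin_g2: "T2 (g2 L0) \<noteq> T2 (g2 L)" if "L \<in> loops F S - {L0}" for L
  proof
    have L: "L \<in> loops F S" "L \<noteq> L0" using that by auto
    assume "T2 (g2 L0) = T2 (g2 L)"
    then have "g2 L0 = g2 L"
      using T2_inj[OF g2_loop(1)[OF L0(1)] g2_loop(1)[OF L(1)] AB0(1)] AB0(1) by simp
    from g2_inj[OF L0(1) L(1) this] L(2) show False by simp
  qed
  have notin_C: "B0 \<notin> T2 (g2 L)" if "L \<in> loops F S" for L
    using T2_inj[OF C_loop g2_loop(1)[OF that] AB0(2)] C_notin[OF that] by metis
  have notin: "T2 (g2 L0) \<notin> ?\<L>" "T2 C \<notin> ?\<L>"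
    using notin_g2 notin_C AB0(2) by auto
  have disj: "A0 \<notin> T2 C" "B0 \<notin> T2 (g2 L0)"
    using T2_inj[OF g2_loop(1)[OF L0(1)] C_loop AB0(1)] C_notin[OF L0(1)] notin_C[OF L0(1)] by auto
  have "saddle_coeff ?n ?n' = of_bool ((\<forall>K \<in> ?\<L>. ?n' K = ?n K) \<and>
      ?n' (T2 (g2 L0)) = Some Minus \<and> ?n' (T2 C) = Some Minus)"
  proof (rule saddle_coeff_split_Minus[OF dom_n _ dom_n'])
    show "?n (T2 (g2 L0) \<union> T2 C) = Some Minus"
      using n[OF L0(1)] m(2) unfolding T1_L0 by (simp add: L0_def a_def F_def)
    show "T2 (g2 L0) \<noteq> T2 C" using AB0 disj by blast
    show "T2 (g2 L0) \<notin> dom ?n" "T2 C \<notin> dom ?n"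
      unfolding dom_n using notin AB0 disj by (simp_all add: set_eq_iff) blast+
  qed
  also have "(\<forall>K \<in> ?\<L>. ?n' K = ?n K) \<longleftrightarrow> (\<forall>L \<in> loops F S - {L0}. m' (g2 L) = m L)"
    using n'[OF g2_loop(1)] n_L by simp
  also have "?n' (T2 (g2 L0)) = m' (g2 L0)" by (rule n'[OF g2_loop(1)[OF L0(1)]])
  also have "?n' (T2 C) = m' C" by (rule n'[OF C_loop])
  also have "((\<forall>L \<in> loops F S - {L0}. m' (g2 L) = m L) \<and> m' (g2 L0) = Some Minus \<and> m' C = Some Minus)
      \<longleftrightarrow> (\<forall>L \<in> loops F S. m' (g2 L) = m L) \<and> m' C = Some Minus"
    using m(2) L0(1) by (auto simp: L0_def a_def F_def)
  also have "\<dots> \<longleftrightarrow> (\<forall>K \<in> loops (U @ P\<^sub>2 @ W) S. m' K = pull (U @ P\<^sub>2 @ W) S r2 m K)"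
  proof -
    have "pull (U @ P\<^sub>2 @ W) S r2 m (g2 L) = m L" if "L \<in> loops F S" for L
      using pull_eq[OF g2_loop(1)[OF that]] g2_loop(2)[OF that] that m(1) by (simp add: F_def)
    moreover have "pull (U @ P\<^sub>2 @ W) S r2 m C = Some Minus"
    proof (rule pull_outside[OF C_loop])
      have "r2 ` C = {(a, w)}" using C_ne by (auto simp: C_def)
      then show "r2 ` C \<notin> dom m" using subF aw m(1) by (auto simp: F_def)
    qed
    ultimately show ?thesis unfolding loops2 by (simp add: conj_commute)
  qed
  also have "\<dots> \<longleftrightarrow> m' = pull (U @ P\<^sub>2 @ W) S r2 m"
  proof (intro iffI ext)
    fix K assume *: "\<forall>K \<in> loops (U @ P\<^sub>2 @ W) S. m' K = pull (U @ P\<^sub>2 @ W) S r2 m K"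
    show "m' K = pull (U @ P\<^sub>2 @ W) S r2 m K"
    proof (cases "K \<in> loops (U @ P\<^sub>2 @ W) S")
      case False
      then have "K \<notin> dom m'" "K \<notin> dom (pull (U @ P\<^sub>2 @ W) S r2 m)" by (simp_all add: m')
      then show ?thesis unfolding domIff by simp
    qed (use * in simp)
  qed simp
  finally show ?thesis by (simp add: a_def r1_def r2_def len)
qed


section \<open>Resolving a central crossing\<close>

lemma bent_levels:
  assumes "i + 1 < w"
  shows "(t, j) \<in> box_points 0 w [Cup (i + 1) u', Cap i, Cup i u, Cross c Tau (i + 2), Cap (i + 1)] \<longleftrightarrow>
    t \<le> 5 \<and> j < (if t \<in> {1, 3, 4} then w + 2 else w)"
proof -
  consider "t = 0" | "t = 1" | "t = 2" | "t = 3" | "t = 4" | "t = 5" | "5 < t" by linarith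
  then show ?thesis unfolding bent_points[OF assms] by cases simp_all
qed

lemma circle_levels:
  assumes "i + 1 < w"
  shows "(t, j) \<in> box_points 0 w [Cup (i + 1) u', Cross c Tau (i + 2), Cap (i + 1)] \<longleftrightarrow>
    t \<le> 3 \<and> j < (if t \<in> {1, 2} then w + 2 else w)"
proof -
  consider "t = 0" | "t = 1" | "t = 2" | "t = 3" | "3 < t" by linarith
  then show ?thesis unfolding circle_points[OF assms] by cases simp_all
qed

lemma crossings_append [simp]: "crossings (xs @ ys) = crossings xs \<union> crossings ys"
  by (simp add: crossings_def crossing_labels_def)

lemma crossings_Cons [simp]:
  "crossings [] = {}" "crossings (Cup i u # xs) = crossings xs" "crossings (Cap i # xs) = crossings xs"
  "crossings (Cross c t i # xs) = insert c (crossings xs)"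
  by (simp_all add: crossings_def crossing_labels_def)

text \<open>
  The three steps of the resolution are followed on a basis vector whose strand \<open>i\<close> is marked \<open>v\<^sub>-\<close>:
  the isotopy does not change loops, the saddle splits off a circle marked \<open>v\<^sub>-\<close>, and the
  Reidemeister I map removes this circle.
\<close>

lemma resolve_map_ket:
  assumes U: "spans 0 U w" and W: "spans w W 0" and i: "i + 1 < w" and c: "c \<notin> S"
    and S: "S \<subseteq> crossings (U @ W)" and m: "dom m = loops (U @ W) S"
    and minus: "m (loop_of (U @ W) S (length U, i)) = Some Minus"
  shows "resolve_map U c i u W (ket (S, pull (U @ [Cross c Tau i] @ W) S (retract (length U) 1 snd) m)) =
    ket (S, m)"
proof -
  define P1 where "P1 = [Cup (i + 1) (\<not> u), Cap i, Cup i u, Cross c Tau (i + 2), Cap (i + 1)]"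
  define P2 where "P2 = [Cup (i + 1) (\<not> u), Cross c Tau (i + 2), Cap (i + 1)]"
  define \<phi>1 :: "point \<Rightarrow> nat" where "\<phi>1 = (\<lambda>(t, j). if t \<in> {1, 3, 4} then bend i i j else j)"
  define \<phi>2 :: "point \<Rightarrow> nat" where "\<phi>2 = (\<lambda>(t, j). if t \<in> {1, 2} then bend i w j else j)"
  have len: "length P1 = 5" "length P2 = 3" by (simp_all add: P1_def P2_def)
  have "straight S w [Cross c Tau i]"
    using c i by (simp add: straight_def vertical_def)
  then have b0: "box U [Cross c Tau i] W S w snd" by (rule straight_box[OF U W])
  have b1: "box U P1 W S w \<phi>1" unfolding P1_def \<phi>1_def by (rule bent_box[OF U W i c])
  have b2: "box U P2 W S w \<phi>2" unfolding P2_def \<phi>2_def by (rule circle_box[OF U W i c])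
  have crossings': "S \<subseteq> crossings (U @ [Cross c Tau i] @ W)" "S \<subseteq> crossings (U @ P1 @ W)"
    "S \<subseteq> crossings (U @ P2 @ W)"
    using S by (auto simp: P1_def P2_def)
  note lev1 = bent_levels[OF i, of _ _ "\<not> u" u c, folded P1_def]
  note lev2 = circle_levels[OF i, of _ _ "\<not> u" c, folded P2_def]
  have \<phi>1_less: "\<phi>1 x < w" if "x \<in> box_points 0 w P1" for x
    using that i by (cases x) (auto simp: lev1 \<phi>1_def bend_def split: if_splits)
  have "isotopy_map U [Cross c Tau i] P1 W
      (ket (S, pull (U @ [Cross c Tau i] @ W) S (retract (length U) 1 snd) m)) =
    ket (S, pull (U @ P1 @ W) S (retract (length U) 5 \<phi>1) m)"
    using isotopy_map_ket[OF b0 b1 \<phi>1_less m crossings'(1,2)] by (simp add: len)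
  moreover have "saddle_map (U @ [Cup (i + 1) (\<not> u)]) [Cap i, Cup i u] []
      ([Cross c Tau (i + 2), Cap (i + 1)] @ W)
      (ket (S, pull (U @ P1 @ W) S (retract (length U) 5 \<phi>1) m)) =
    scale 1 (ket (S, pull (U @ P2 @ W) S (retract (length U) 3 \<phi>2) m))" (is "?l = _")
  proof -
    have eqs: "(U @ [Cup (i + 1) (\<not> u)]) @ [Cap i, Cup i u] @ [Cross c Tau (i + 2), Cap (i + 1)] @ W =
        U @ P1 @ W"
      "(U @ [Cup (i + 1) (\<not> u)]) @ [] @ [Cross c Tau (i + 2), Cap (i + 1)] @ W = U @ P2 @ W"
      "length (U @ [Cup (i + 1) (\<not> u)]) = length U + 1" "length [Cap i, Cup i u] = 2"
      "length ([] :: layer list) = 0"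
      by (simp_all add: P1_def P2_def)
    show ?thesis
      unfolding saddle_map_def eqs
    proof (rule lin_ket_eq)
      fix \<beta> assume \<beta>: "\<beta> \<in> estates (U @ P2 @ W)"
      obtain S' m' where \<beta>_eq: "\<beta> = (S', m')" by (cases \<beta>)
      show "(case (S, pull (U @ P1 @ W) S (retract (length U) 5 \<phi>1) m) of
          (S, m) \<Rightarrow> \<lambda>(S', m'). of_bool (S' = S) *
            saddle_coeff (outer (length U + 1) 2 m) (outer (length U + 1) 0 m')) \<beta> =
        1 * of_bool (\<beta> = (S, pull (U @ P2 @ W) S (retract (length U) 3 \<phi>2) m))"
      proof (cases "S' = S")
        case True
        then have "dom m' = loops (U @ P2 @ W) S" using \<beta> by (simp add: \<beta>_eq estates_def)
        from saddle_coeff_bent[OF b1 b2 len i \<phi>1_def \<phi>2_def lev1 lev2 m minus this] True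
        show ?thesis by (simp add: \<beta>_eq)
      qed (simp add: \<beta>_eq)
    qed (use crossings' in \<open>simp_all add: estates_def\<close>)
  qed
  moreover have "RI_map U P2 c W (ket (S, pull (U @ P2 @ W) S (retract (length U) 3 \<phi>2) m)) = ket (S, m)"
    using box.RI_map_ket[OF b2 m c crossings'(3) S] by (simp add: len)
  ultimately show ?thesis
    by (simp add: resolve_map_def P1_def P2_def Let_def)
qed

section \<open>Inserting a braid word\<close>

text \<open>
  A smoothed diagram depends only on the labels of its own crossings.  Hence labels of crossings that
  are added or removed elsewhere can be ignored.
\<close>

lemma box_links_cong:
  "S \<inter> crossings xs = T \<inter> crossings xs \<Longrightarrow> box_links S t w xs = box_links T t w xs"
proof (induction xs arbitrary: t w)
  case (Cons x xs)
  have "links S t w x = links T t w x" using Cons.prems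
    by (cases x) (auto simp: vertical_def)
  moreover have "S \<inter> crossings xs = T \<inter> crossings xs" using Cons.prems by (cases x) auto
  ultimately show ?case using Cons.IH by simp
qed simp

lemma connected_in_cong:
  "S \<inter> crossings D = T \<inter> crossings D \<Longrightarrow> connected_in D S = connected_in D T"
  unfolding connected_in_box by (metis box_links_cong)

lemma loop_of_cong: "S \<inter> crossings D = T \<inter> crossings D \<Longrightarrow> loop_of D S = loop_of D T"
  by (auto simp: fun_eq_iff loop_of_def dest: connected_in_cong)

lemma loops_cong: "S \<inter> crossings D = T \<inter> crossings D \<Longrightarrow> loops D S = loops D T"
  by (simp add: loops_def loop_of_cong[of S D T])

lemma (in box) image_loops:
  assumes "\<And>x. x \<in> box_points 0 w P \<Longrightarrow> \<phi> x < w"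
  shows "(`) r ` loops (U @ P @ W) S = loops (U @ W) S"
proof (intro equalityI subsetI)
  fix L assume "L \<in> (`) r ` loops (U @ P @ W) S"
  then obtain K where K: "K \<in> loops (U @ P @ W) S" "L = r ` K" by (rule imageE)
  show "L \<in> loops (U @ W) S" unfolding K(2) by (rule circle_free[OF assms K(1)])
next
  fix L assume L: "L \<in> loops (U @ W) S"
  show "L \<in> (`) r ` loops (U @ P @ W) S"
    by (rule image_eqI[where f = "(`) r", OF preimage_loop(2)[OF L, symmetric] preimage_loop(1)[OF L]])
qed

lemma tangle_append [simp]: "tangle p (xs @ ys) = tangle p xs @ tangle p ys"
  by (simp add: tangle_def)

lemma length_tangle [simp]: "length (tangle p ls) = length ls"
  by (simp add: tangle_def)

lemma crossings_tangle [simp]: "crossings (tangle p ls) = fst ` set ls"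
proof (induction ls)
  case (Cons x ls)
  then show ?case by (cases x) (simp add: tangle_def)
qed (simp add: tangle_def)

definition negatives :: "letter list \<Rightarrow> nat set" where
  "negatives ls = {c. \<exists>i. (c, TauInv, i) \<in> set ls}"

lemma negatives_append [simp]: "negatives (xs @ ys) = negatives xs \<union> negatives ys"
  by (auto simp: negatives_def)

lemma negatives_Cons [simp]:
  "negatives [] = {}" "negatives ((c, Tau, i) # xs) = negatives xs"
  "negatives ((c, TauInv, i) # xs) = insert c (negatives xs)"
  by (auto simp: negatives_def)

lemma negatives_subset: "negatives ls \<subseteq> fst ` set ls"
  by (force simp: negatives_def)

text \<open>
  The strands \<open>p, \<dots>, p + n - 1\<close> between \<open>X\<close> and \<open>Y\<close> lie on different loops, all marked \<open>v\<^sub>-\<close>.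
\<close>

locale parallel_arcs =
  fixes X Y :: "layer list" and p n w :: nat and S :: "nat set" and m :: "point marking"
  assumes below: "spans 0 X w" and above: "spans w Y 0" and strands: "p + n \<le> w"
    and S: "S \<subseteq> crossings (X @ Y)" and m: "dom m = loops (X @ Y) S"
    and distinct_loops: "inj_on (\<lambda>j. loop_of (X @ Y) S (length X, j)) {p..<p + n}"
    and minus: "j \<in> {p..<p + n} \<Longrightarrow> m (loop_of (X @ Y) S (length X, j)) = Some Minus"
begin

definition fresh :: "letter list \<Rightarrow> bool" where
  "fresh ls \<longleftrightarrow> distinct (map fst ls) \<and> fst ` set ls \<inter> crossings (X @ Y) = {} \<and>
    (\<forall>x \<in> set ls. snd (snd x) + 1 < n)"

abbreviation diag :: "letter list \<Rightarrow> diagram" where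
  "diag ls \<equiv> X @ tangle p ls @ Y"

definition smoothing :: "letter list \<Rightarrow> nat set" where
  "smoothing ls = S \<union> negatives ls"

text \<open>
  The states that are followed through the movie: for every word \<open>ls\<close>, including those in the middle
  of the movie, the positive letters are 0-smoothed, the negative ones are 1-smoothed, and the marks
  come from the diagram without the braid.
\<close>

definition marks :: "letter list \<Rightarrow> point marking" where
  "marks ls = pull (diag ls) (smoothing ls) (collapse (length X) (length ls)) m"

text \<open>
  No label occurs twice, so the label of a letter is 1-smoothed only on account of this letter.
\<close>

lemma smoothing_iff:
  assumes "fresh ls" "(c, t, i) \<in> set ls"
  shows "c \<in> smoothing ls \<longleftrightarrow> t = TauInv"
proof -
  have "c \<notin> S" using assms S by (force simp: fresh_def)
  moreover have "t = TauInv" if "(c, TauInv, i') \<in> set ls" for i'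
    using assms that by (metis eq_key_imp_eq_value fresh_def prod.inject)
  ultimately show ?thesis using assms(2) by (auto simp: smoothing_def negatives_def)
qed

lemma smoothing_old: "fresh ls \<Longrightarrow> smoothing ls \<inter> crossings (X @ Y) = S"
  using S negatives_subset[of ls] by (fastforce simp: fresh_def smoothing_def)

text \<open>
  The smoothing may be changed at crossings outside the word; this is used for the changes at crossings
  of the original diagram.
\<close>

lemma straight_word:
  assumes "fresh ls" "set zs \<subseteq> set ls" "\<And>c. c \<in> fst ` set ls \<Longrightarrow> c \<in> T \<longleftrightarrow> c \<in> smoothing ls"
  shows "straight T w (tangle p zs)"
  unfolding straight_def
proof
  fix x assume "x \<in> set (tangle p zs)"
  then obtain c t i where x: "x = Cross c t (p + i)" "(c, t, i) \<in> set ls"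
    using assms(2) by (auto simp: tangle_def)
  moreover have "i + 1 < n" using x(2) assms(1) by (force simp: fresh_def)
  moreover have "c \<in> T \<longleftrightarrow> t = TauInv" using assms(3) smoothing_iff[OF assms(1) x(2)] x(2) by force
  ultimately show "\<exists>c t i. x = Cross c t i \<and> i + 1 < w \<and> vertical T c t"
    using strands by (auto simp: vertical_def)
qed

lemma word_box:
  assumes "fresh ls" "\<And>c. c \<in> fst ` set ls \<Longrightarrow> c \<in> T \<longleftrightarrow> c \<in> smoothing ls"
  shows "box X (tangle p ls) Y T w snd"
  using straight_box[OF below above straight_word[OF assms(1) order.refl assms(2)]] .

lemma subword_box:
  assumes "fresh (xs @ zs @ ys)"
  shows "box (X @ tangle p xs) (tangle p zs) (tangle p ys @ Y) (smoothing (xs @ zs @ ys)) w snd"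
proof (rule straight_box)
  have *: "spans w (tangle p qs) w" if "set qs \<subseteq> set (xs @ zs @ ys)" for qs
    by (rule straight_spans[OF straight_word[OF assms that]]) simp
  show "spans 0 (X @ tangle p xs) w" "spans w (tangle p ys @ Y) 0"
    by (rule spans_appendI[OF below *], simp, rule spans_appendI[OF * above], auto)
  show "straight (smoothing (xs @ zs @ ys)) w (tangle p zs)"
    by (rule straight_word[OF assms]) auto
qed

lemma straight_less: "straight T w P \<Longrightarrow> x \<in> box_points 0 w P \<Longrightarrow> snd x < w"
  using box_points_straight by blast

lemma fresh_delete: "fresh (xs @ zs @ ys) \<Longrightarrow> fresh (xs @ ys)"
  by (auto simp: fresh_def)

lemma loops_delete:
  assumes "fresh (xs @ zs @ ys)"
  shows "loops (X @ tangle p xs @ tangle p ys @ Y) (smoothing (xs @ zs @ ys)) =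
    loops (X @ tangle p xs @ tangle p ys @ Y) (smoothing (xs @ ys))"
proof (rule loops_cong)
  have "fst ` set zs \<inter> crossings (X @ tangle p xs @ tangle p ys @ Y) = {}"
    using assms unfolding fresh_def by (simp add: image_Un) blast
  then have "negatives zs \<inter> crossings (X @ tangle p xs @ tangle p ys @ Y) = {}"
    using negatives_subset[of zs] by blast
  then show "smoothing (xs @ zs @ ys) \<inter> crossings (X @ tangle p xs @ tangle p ys @ Y) =
      smoothing (xs @ ys) \<inter> crossings (X @ tangle p xs @ tangle p ys @ Y)"
    by (auto simp: smoothing_def)
qed

lemma dom_marks [simp]: "dom (marks ls) = loops (diag ls) (smoothing ls)"
  by (simp add: marks_def)

text \<open>
  Collapsing the whole word at once is the same as collapsing first the letters \<open>zs\<close> and then the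
  rest.  So the state of a word is pulled back from the state of the word after a step of the movie,
  as the lemmas on elementary chain maps require.
\<close>

lemma marks_delete:
  assumes "fresh (xs @ zs @ ys)"
  shows "marks (xs @ zs @ ys) = pull (diag (xs @ zs @ ys)) (smoothing (xs @ zs @ ys))
    (retract (length (X @ tangle p xs)) (length zs) snd) (marks (xs @ ys))"
proof
  fix K
  let ?U = "X @ tangle p xs" and ?W = "tangle p ys @ Y" and ?S = "smoothing (xs @ zs @ ys)"
  let ?r = "retract (length ?U) (length zs) snd"
  interpret box ?U "tangle p zs" ?W ?S w snd by (rule subword_box[OF assms])
  have eq: "?U @ tangle p zs @ ?W = diag (xs @ zs @ ys)" "?U @ ?W = diag (xs @ ys)"
    by simp_all
  have straight: "straight ?S w (tangle p zs)" by (rule straight_word[OF assms]) auto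
  show "marks (xs @ zs @ ys) K = pull (diag (xs @ zs @ ys)) ?S ?r (marks (xs @ ys)) K"
  proof (cases "K \<in> loops (diag (xs @ zs @ ys)) ?S")
    case True
    then have "?r ` K \<in> loops (diag (xs @ ys)) ?S"
      using circle_free[OF straight_less[OF straight], of K] unfolding eq by simp
    then have "?r ` K \<in> loops (diag (xs @ ys)) (smoothing (xs @ ys))"
      using loops_delete[OF assms] by simp
    moreover have "collapse (length X) (length (xs @ zs @ ys)) x =
        collapse (length X) (length (xs @ ys)) (?r x)" for x
      by (cases x) (auto simp: collapse_def retract_def)
    then have "collapse (length X) (length (xs @ zs @ ys)) ` K =
        collapse (length X) (length (xs @ ys)) ` ?r ` K"
      by (simp add: image_image)
    ultimately show ?thesis
      using True by (simp add: marks_def pull_def)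
  qed (simp add: marks_def pull_def)
qed

lemma collapse_strand:
  assumes "fresh ls" "k \<le> length ls" "j < w"
  shows "(length X + k, j) \<in> points (diag ls)"
    and "collapse (length X) (length ls) ` loop_of (diag ls) (smoothing ls) (length X + k, j) =
      loop_of (X @ Y) S (length X, j)"
proof -
  interpret box X "tangle p ls" Y "smoothing ls" w snd by (rule word_box[OF assms(1)]) simp
  have "(k, j) \<in> box_points 0 w (tangle p ls)"
  proof -
    have "set (take k ls) \<subseteq> set ls" by (rule set_take_subset)
    from straight_spans[OF straight_word[OF assms(1) this]]
    have "spans w (tangle p (take k ls)) w" by simp
    then have "fold strands_above (take k (tangle p ls)) w = w"
      by (metis fold_spans take_map tangle_def)
    then show ?thesis using assms(2,3) by (simp add: mem_box_points)
  qed
  then show px: "(length X + k, j) \<in> points (diag ls)" using points_mid assms(2) by simp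
  have rx: "r (length X + k, j) = (length X, j)" using r_mid[of k j] assms(2) by simp
  have "(length X, j) \<in> points (X @ Y)"
    using assms(3) fold_spans[OF below] by (simp add: points_def width_fold)
  then have "r ` loop_of (diag ls) (smoothing ls) (length X + k, j) =
      loop_of (X @ Y) (smoothing ls) (length X, j)"
    using image_loop_of[OF px, unfolded rx] by simp
  also have "\<dots> = loop_of (X @ Y) S (length X, j)"
    using loop_of_cong[of "smoothing ls" "X @ Y" S] smoothing_old[OF assms(1)] S
    by (simp add: inf.absorb1)
  finally show "collapse (length X) (length ls) `
      loop_of (diag ls) (smoothing ls) (length X + k, j) = loop_of (X @ Y) S (length X, j)"
    by (simp add: collapse_retract)
qed

text \<open>
  At every height inside the braid the strands are still the given arcs, marked \<open>v\<^sub>-\<close>.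
\<close>

lemma marks_strand:
  assumes "fresh ls" "k \<le> length ls" "j \<in> {p..<p + n}"
  shows "marks ls (loop_of (diag ls) (smoothing ls) (length X + k, j)) = Some Minus"
proof -
  have j: "j < w" using assms(3) strands by simp
  note strand = collapse_strand[OF assms(1,2) j]
  then show ?thesis
    unfolding marks_def using pull_eq[OF loop_of_in_loops[OF strand(1)]] minus[OF assms(3)]
    by (metis domI)
qed

lemma smoothing_subset: "smoothing ls \<subseteq> crossings (diag ls)"
  using S negatives_subset[of ls] by (auto simp: smoothing_def)

lemma resolve_letter:
  assumes fresh: "fresh (xs @ [(c, Tau, i)] @ ys)"
  shows "resolve_map (X @ tangle p xs) c (p + i) u (tangle p ys @ Y)
      (ket (smoothing (xs @ [(c, Tau, i)] @ ys), marks (xs @ [(c, Tau, i)] @ ys))) =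
    ket (smoothing (xs @ ys), marks (xs @ ys))"
proof -
  let ?U = "X @ tangle p xs" and ?W = "tangle p ys @ Y"
  interpret box ?U "tangle p [(c, Tau, i)]" ?W "smoothing (xs @ [(c, Tau, i)] @ ys)" w snd
    by (rule subword_box[OF fresh])
  have i: "i + 1 < n" using fresh by (auto simp: fresh_def)
  have sm: "smoothing (xs @ [(c, Tau, i)] @ ys) = smoothing (xs @ ys)"
    by (simp add: smoothing_def)
  have marks: "marks (xs @ [(c, Tau, i)] @ ys) =
      pull (?U @ [Cross c Tau (p + i)] @ ?W) (smoothing (xs @ ys)) (retract (length ?U) 1 snd) (marks (xs @ ys))"
    using marks_delete[OF fresh] unfolding sm by (simp add: tangle_def)
  have U: "length ?U = length X + length xs" by simp
  show ?thesis
    unfolding marks sm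
  proof (rule resolve_map_ket[OF below above])
    show "p + i + 1 < w" using i strands by simp
    show "c \<notin> smoothing (xs @ ys)"
      using smoothing_iff[OF fresh, of c Tau i] unfolding sm by simp
    show "smoothing (xs @ ys) \<subseteq> crossings (?U @ ?W)" using smoothing_subset[of "xs @ ys"] by simp
    show "dom (marks (xs @ ys)) = loops (?U @ ?W) (smoothing (xs @ ys))" by simp
    show "marks (xs @ ys) (loop_of (?U @ ?W) (smoothing (xs @ ys)) (length ?U, p + i)) = Some Minus"
      using marks_strand[OF fresh_delete[OF fresh], of "length xs" "p + i"] i unfolding U by simp
  qed
qed

text \<open>
  Only the set of the two letters matters, so this covers both orders in which a letter and its
  inverse can meet.
\<close>

lemma RII_letters:
  assumes fresh: "fresh (xs @ zs @ ys)" and zs: "set zs = {(a, Tau, i), (b, TauInv, i)}"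
  shows "\<exists>s \<in> {1, -1}. RII_map (X @ tangle p xs) (tangle p zs) a b (tangle p ys @ Y)
      (ket (smoothing (xs @ zs @ ys), marks (xs @ zs @ ys))) =
    scale s (ket (smoothing (xs @ ys), marks (xs @ ys)))"
proof -
  let ?U = "X @ tangle p xs" and ?W = "tangle p ys @ Y" and ?S = "smoothing (xs @ zs @ ys)"
  interpret box ?U "tangle p zs" ?W ?S w snd by (rule subword_box[OF fresh])
  have ab: "a \<notin> ?S" "b \<in> ?S"
    using smoothing_iff[OF fresh, of a Tau i] smoothing_iff[OF fresh, of b TauInv i] zs by auto
  have "b \<notin> fst ` set (xs @ ys)" "b \<notin> S" "negatives zs = {b}"
    using fresh zs S by (auto simp: fresh_def negatives_def)
  then have sm: "?S - {b} = smoothing (xs @ ys)"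
    using negatives_subset[of "xs @ ys"] by (auto simp: smoothing_def)
  have marks: "marks (xs @ zs @ ys) = pull (?U @ tangle p zs @ ?W) ?S
      (retract (length ?U) (length (tangle p zs)) snd) (marks (xs @ ys))"
    using marks_delete[OF fresh] by simp
  have "RII_map ?U (tangle p zs) a b ?W (ket (?S, marks (xs @ zs @ ys))) =
      scale ((-1) ^ card {x \<in> ?S. b < x}) (ket (?S - {b}, marks (xs @ ys)))"
    unfolding marks
  proof (rule RII_map_ket)
    show "dom (marks (xs @ ys)) = loops (?U @ ?W) ?S" "loops (?U @ ?W) (?S - {b}) = loops (?U @ ?W) ?S"
      using loops_delete[OF fresh] by (simp_all add: sm)
    show "?S \<subseteq> crossings (?U @ tangle p zs @ ?W)" "?S - {b} \<subseteq> crossings (?U @ ?W)"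
      using smoothing_subset[of "xs @ zs @ ys"] smoothing_subset[of "xs @ ys"] unfolding sm by simp_all
  qed (rule ab)+
  moreover have "(-1) ^ k \<in> {1, -1 :: rat}" for k
    by (cases "even k") simp_all
  ultimately show ?thesis unfolding sm by blast
qed

lemma cancel_letters:
  assumes "fresh (xs @ [x, y] @ ys)" "snd y = (inv_twist (fst (snd x)), snd (snd x))"
  shows "\<exists>s \<in> {1, -1}. cancel_map (X @ tangle p xs) x y p (tangle p ys @ Y)
      (ket (smoothing (xs @ [x, y] @ ys), marks (xs @ [x, y] @ ys))) =
    scale s (ket (smoothing (xs @ ys), marks (xs @ ys)))"
proof -
  obtain c t i where x: "x = (c, t, i)" by (cases x)
  then obtain d where y: "y = (d, inv_twist t, i)" using assms(2) by (cases y) auto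
  show ?thesis
  proof (cases t)
    case Tau
    then have "set [x, y] = {(c, Tau, i), (d, TauInv, i)}" by (simp add: x y)
    from RII_letters[OF assms(1) this] show ?thesis by (simp add: cancel_map_def x y Tau)
  next
    case TauInv
    then have "set [x, y] = {(d, Tau, i), (c, TauInv, i)}" by (auto simp: x y)
    from RII_letters[OF assms(1) this] show ?thesis by (simp add: cancel_map_def x y TauInv)
  qed
qed

lemma jacobsson_scale:
  "jacobsson_chain_map X p u Y bs f \<Longrightarrow> f (scale s x) = scale s (f x)"
  by (induction arbitrary: x rule: jacobsson_chain_map.induct)
    (simp_all add: resolve_map_def cancel_map_def RI_map_def RII_map_def saddle_map_def
      isotopy_map_def Let_def lin_scale)

lemma braid_word_append [simp]: "braid_word (bs @ bs') = braid_word bs @ braid_word bs'"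
  and braid_word_Cons: "braid_word (b # bs) = block_word b @ braid_word bs"
  by (simp_all add: braid_word_def)

lemma marks_Nil: "marks [] = m"
proof
  fix K
  have "collapse (length X) 0 = id" by (auto simp: collapse_def fun_eq_iff)
  then have "marks [] = pull (X @ Y) S id m" by (simp add: marks_def smoothing_def tangle_def)
  moreover have "pull (X @ Y) S id m K = m K"
  proof (cases "K \<in> dom m")
    case True
    then show ?thesis using pull_eq[of K "X @ Y" S id m] unfolding m by simp
  next
    case False
    then have "K \<notin> loops (X @ Y) S" using m by simp
    then show ?thesis using False unfolding pull_def domIff by simp
  qed
  ultimately show "marks [] K = m K" by simp
qed

text \<open>
  Induction along the movie, with one sign for each Reidemeister II move.  Linearity
  (\<open>jacobsson_scale\<close>) carries the sign of a step through the rest of the movie.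
\<close>

lemma jacobsson_ket:
  assumes "jacobsson_chain_map X p u Y bs f" "fresh (braid_word bs)"
  shows "\<exists>s \<in> {1, -1}. f (ket (smoothing (braid_word bs), marks (braid_word bs))) = scale s (ket (S, m))"
  using assms
proof (induction rule: jacobsson_chain_map.induct)
  case (finished bs)
  then have "\<forall>b \<in> set bs. block_word b = []" by auto
  then have "braid_word bs = []" by (simp add: braid_word_def)
  then show ?case by (simp add: marks_Nil smoothing_def)
next
  case (resolve bs w w' bs' f c i)
  let ?xs = "braid_word bs @ w" and ?ys = "w' @ braid_word bs'"
  have word: "braid_word (bs @ (w, Some (c, Tau, i), w') # bs') = ?xs @ [(c, Tau, i)] @ ?ys"
    "braid_word (bs @ (w, None, w') # bs') = ?xs @ ?ys"
    by (simp_all add: braid_word_Cons)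
  from resolve.prems have fresh: "fresh (?xs @ [(c, Tau, i)] @ ?ys)" unfolding word .
  from resolve.IH fresh_delete[OF fresh] show ?case
    unfolding word using resolve_letter[OF fresh] by simp
next
  case (cancel bs w w' bs' f y x)
  let ?xs = "braid_word bs @ w" and ?ys = "w' @ braid_word bs'"
  have word: "braid_word (bs @ (w @ [x], None, y # w') # bs') = ?xs @ [x, y] @ ?ys"
    "braid_word (bs @ (w, None, w') # bs') = ?xs @ ?ys"
    by (simp_all add: braid_word_Cons)
  from cancel.prems have fresh: "fresh (?xs @ [x, y] @ ?ys)" unfolding word .
  from cancel.IH[unfolded word, OF fresh_delete[OF fresh]] obtain s where
    s: "s \<in> {1, -1}" "f (ket (smoothing (?xs @ ?ys), marks (?xs @ ?ys))) = scale s (ket (S, m))" by blast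
  from cancel_letters[OF fresh cancel.hyps(3)] obtain s' where
    s': "s' \<in> {1, -1}" "cancel_map (X @ tangle p ?xs) x y p (tangle p ?ys @ Y)
      (ket (smoothing (?xs @ [x, y] @ ?ys), marks (?xs @ [x, y] @ ?ys))) =
      scale s' (ket (smoothing (?xs @ ?ys), marks (?xs @ ?ys)))" by blast
  have "s' * s \<in> {1, -1}" using s(1) s'(1) by auto
  moreover have "(f \<circ> cancel_map (X @ tangle p ?xs) x y p (tangle p ?ys @ Y))
      (ket (smoothing (?xs @ [x, y] @ ?ys), marks (?xs @ [x, y] @ ?ys))) = scale (s' * s) (ket (S, m))"
    using s(2) s'(2) jacobsson_scale[OF cancel.hyps(1)] by simp
  ultimately show ?case unfolding word by (intro bexI) (simp_all only: append_assoc tangle_append)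
qed

text \<open>
  The points \<open>q\<close> and \<open>q'\<close> just below the crossing lie on different loops.  After the change they are
  joined by a cap, so no loop contains just one of them and neither of the two loops is left.
\<close>

lemma no_saddle_new_crossing:
  assumes fresh: "fresh ls" and c: "(c, Tau, i) \<in> set ls"
    and m': "dom m' = loops (diag ls) (insert c (smoothing ls))"
  shows "\<not> merges (marks ls) m' \<and> \<not> splits (marks ls) m'"
proof -
  obtain xs ys where ls: "ls = xs @ (c, Tau, i) # ys" using c by (meson split_list)
  have i: "i + 1 < n" using fresh c by (force simp: fresh_def)
  let ?D = "diag ls" and ?S = "smoothing ls"
  define q where "q = (length X + length xs, p + i)"
  define q' where "q' = (length X + length xs, p + i + 1)"
  have k: "length xs \<le> length ls" and j: "p + i < w" "p + i + 1 < w"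
    using i strands by (simp_all add: ls)
  note A = collapse_strand[OF fresh k j(1), folded q_def]
  note B = collapse_strand[OF fresh k j(2), folded q'_def]
  have ne: "loop_of ?D ?S q \<noteq> loop_of ?D ?S q'"
  proof
    assume "loop_of ?D ?S q = loop_of ?D ?S q'"
    then have "loop_of (X @ Y) S (length X, p + i) = loop_of (X @ Y) S (length X, p + i + 1)"
      using A(2) B(2) by metis
    from inj_onD[OF distinct_loops this] i show False by simp
  qed
  have "fold strands_above (X @ tangle p xs) 0 = w"
  proof -
    have "spans w (tangle p xs) w"
      by (rule straight_spans[OF straight_word[OF fresh]]) (auto simp: ls)
    from fold_spans[OF spans_appendI[OF below this]] show ?thesis .
  qed
  moreover have "(q, q') \<in> links (insert c ?S) (length X + length xs) w (Cross c Tau (p + i))"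
    by (simp add: vertical_def q_def q'_def)
  ultimately have "(q, q') \<in> box_links (insert c ?S) 0 0
      ((X @ tangle p xs) @ Cross c Tau (p + i) # tangle p ys @ Y)"
    unfolding box_links_append by simp
  also have "(X @ tangle p xs) @ Cross c Tau (p + i) # tangle p ys @ Y = ?D"
    unfolding ls by (simp add: tangle_def)
  finally have "(q, q') \<in> connected_in ?D (insert c ?S)"
    unfolding connected_in_box by (rule linked_edge)
  then have new: "loop_of ?D (insert c ?S) q = loop_of ?D (insert c ?S) q'"
    by (simp add: loop_of_eq)
  have gone: "loop_of ?D ?S x \<notin> dom m'" if "x \<in> {q, q'}" for x
  proof
    assume "loop_of ?D ?S x \<in> dom m'"
    then have "loop_of ?D ?S x \<in> loops ?D (insert c ?S)" by (simp add: m')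
    then have "loop_of ?D ?S x = loop_of ?D (insert c ?S) x"
      using loops_eq_loop_of loop_of_self by blast
    also have "\<dots> = loop_of ?D (insert c ?S) q" using that new by (elim insertE) simp_all
    finally have eq: "loop_of ?D ?S x = loop_of ?D (insert c ?S) q" .
    have "q \<in> loop_of ?D ?S x" unfolding eq by (rule loop_of_self)
    moreover have "q' \<in> loop_of ?D ?S x" unfolding eq new by (rule loop_of_self)
    ultimately have "loop_of ?D ?S q = loop_of ?D ?S x" "loop_of ?D ?S q' = loop_of ?D ?S x"
      by (simp_all add: loop_of_eq mem_loop_of)
    with ne show False by simp
  qed
  show ?thesis
  proof (rule no_saddle_Minus[OF _ _ ne])
    show "loop_of ?D ?S q \<in> dom (marks ls)" "loop_of ?D ?S q' \<in> dom (marks ls)"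
      using A(1) B(1) by (simp_all add: loop_of_in_loops)
    show "marks ls (loop_of ?D ?S q) = Some Minus" "marks ls (loop_of ?D ?S q') = Some Minus"
      using marks_strand[OF fresh k] i by (simp_all add: q_def q'_def)
  qed (use gone in auto)
qed

lemma collapse_loops:
  assumes "fresh ls"
  shows "bij_betw ((`) (collapse (length X) (length ls))) (loops (diag ls) (smoothing ls)) (loops (X @ Y) S)"
    and "K \<in> loops (diag ls) (smoothing ls) \<Longrightarrow> marks ls K = m (collapse (length X) (length ls) ` K)"
proof -
  let ?S = "smoothing ls" and ?r = "collapse (length X) (length ls)"
  have r: "retract (length X) (length (tangle p ls)) snd = ?r" by (simp add: collapse_retract)
  have straight: "straight ?S w (tangle p ls)" by (rule straight_word[OF assms]) simp_all
  interpret box X "tangle p ls" Y ?S w snd by (rule straight_box[OF below above straight])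
  have "loops (X @ Y) ?S = loops (X @ Y) S"
    using loops_cong[of ?S "X @ Y" S] smoothing_old[OF assms] S by (simp add: inf.absorb1)
  then have im: "(`) ?r ` loops (diag ls) ?S = loops (X @ Y) S"
    using image_loops[OF straight_less[OF straight]] unfolding r by simp
  moreover have "inj_on ((`) ?r) (loops (diag ls) ?S)"
    using saturated unfolding r by (intro inj_on_inverseI[of _ "\<lambda>L. {x \<in> points (diag ls). ?r x \<in> L}"]) blast
  ultimately show "bij_betw ((`) ?r) (loops (diag ls) ?S) (loops (X @ Y) S)"
    by (simp add: bij_betw_def)
  show "marks ls K = m (?r ` K)" if "K \<in> loops (diag ls) ?S"
  proof -
    have "?r ` K \<in> dom m" unfolding m im[symmetric] using that by (rule imageI)
    then show ?thesis unfolding marks_def by (rule pull_eq[OF that])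
  qed
qed

text \<open>
  The word stays straight after the change, so the loops before and after the change both
  correspond to loops of \<open>X @ Y\<close> under the same collapse.  A saddle upstairs with a nonzero coefficient
  would be renamed to one downstairs, which a state cycle does not have.
\<close>

lemma no_saddle_old_crossing:
  assumes fresh: "fresh ls" and cyc: "state_cycle (X @ Y) (S, m)"
    and c: "c \<in> crossings (X @ Y)" "c \<notin> S"
    and m': "dom m' = loops (diag ls) (insert c (smoothing ls))"
  shows "\<not> merges (marks ls) m' \<and> \<not> splits (marks ls) m'"
proof -
  let ?S = "smoothing ls" and ?T = "insert c (smoothing ls)"
  let ?r = "collapse (length X) (length ls)"
  have r: "retract (length X) (length (tangle p ls)) snd = ?r" by (simp add: collapse_retract)
  have c': "c \<notin> fst ` set ls" using c fresh by (auto simp: fresh_def)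
  have straight: "straight T w (tangle p ls)" if "T \<in> {?S, ?T}" for T
    using straight_word[OF fresh order.refl, of T] that c' by auto
  note straight0 = straight[of ?S, simplified] and straight1 = straight[of ?T, simplified]
  interpret b0: box X "tangle p ls" Y ?S w snd
    by (rule straight_box[OF below above straight0])
  interpret b1: box X "tangle p ls" Y ?T w snd
    by (rule straight_box[OF below above straight1])
  have F0: "loops (X @ Y) ?S = loops (X @ Y) S"
    using loops_cong[of ?S "X @ Y" S] smoothing_old[OF fresh] S by (simp add: inf.absorb1)
  have F1: "loops (X @ Y) ?T = loops (X @ Y) (insert c S)"
    using smoothing_old[OF fresh] S c by (intro loops_cong) auto
  have im0: "(`) ?r ` loops (diag ls) ?S = loops (X @ Y) S"
    using b0.image_loops[OF straight_less[OF straight0]] unfolding r F0 by simp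
  have im1: "(`) ?r ` loops (diag ls) ?T = loops (X @ Y) (insert c S)"
    using b1.image_loops[OF straight_less[OF straight1]] unfolding r F1 by simp
  define g where "g = (\<lambda>L. {x \<in> points (diag ls). ?r x \<in> L})"
  have g: "K = g (?r ` K)" if "K \<in> loops (diag ls) ?S \<union> loops (diag ls) ?T" for K
    using that b0.saturated b1.saturated unfolding r g_def by blast
  define n' where "n' = (\<lambda>L. if L \<in> loops (X @ Y) (insert c S) then m' (g L) else None)"
  have n'_eq: "n' (?r ` K) = m' K" if "K \<in> loops (diag ls) ?T" for K
    using g[of K] that im1 by (auto simp: n'_def)
  have dom_n': "dom n' = loops (X @ Y) (insert c S)"
  proof (intro equalityI subsetI)
    fix L assume L: "L \<in> loops (X @ Y) (insert c S)"
    then obtain K where K: "K \<in> loops (diag ls) ?T" "L = ?r ` K" unfolding im1[symmetric] by auto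
    then have "n' L = m' K" "K \<in> dom m'" using n'_eq m' by simp_all
    then show "L \<in> dom n'" by auto
  qed (auto simp: n'_def split: if_splits)
  have "\<not> merges m n' \<and> \<not> splits m n'"
    using cyc c dom_n' unfolding state_cycle_iff by blast
  moreover have "merges m n' \<or> splits m n'" if "merges (marks ls) m' \<or> splits (marks ls) m'"
  proof (rule saddles_image[OF _ _ _ _ _ _ that, of m "(`) ?r" n'])
    show "dom m = (`) ?r ` dom (marks ls)" using im0 m by simp
    show "dom n' = (`) ?r ` dom m'" using im1 dom_n' m' by simp
    show "inj_on ((`) ?r) (dom (marks ls) \<union> dom m')"
      unfolding dom_marks m' using g by (intro inj_on_inverseI[of _ g]) simp
    show "m (?r ` K) = marks ls K" if "K \<in> dom (marks ls)" for K
      using collapse_loops(2)[OF fresh] that by simp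
    show "n' (?r ` K) = m' K" if "K \<in> dom m'" for K
      using that m' n'_eq by simp
  qed (rule image_Un)
  ultimately show ?thesis by blast
qed

lemma state_cycle_braided:
  assumes "fresh ls" "state_cycle (X @ Y) (S, m)"
  shows "state_cycle (diag ls) (smoothing ls, marks ls)"
  unfolding state_cycle_iff
proof (intro conjI[of "_ \<in> _"] ballI allI impI)
  show "(smoothing ls, marks ls) \<in> estates (diag ls)"
    using smoothing_subset by (simp add: estates_def)
  fix c and m' :: "point marking"
  assume c: "c \<in> crossings (diag ls) - smoothing ls"
    and m': "dom m' = loops (diag ls) (insert c (smoothing ls))"
  show "\<not> merges (marks ls) m' \<and> \<not> splits (marks ls) m'"
  proof (cases "c \<in> crossings (X @ Y)")
    case True
    then show ?thesis
      using no_saddle_old_crossing[OF assms True _ m'] c by (simp add: smoothing_def)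
  next
    case False
    then obtain t i where "(c, t, i) \<in> set ls" using c by auto
    moreover from this have "t = Tau" using smoothing_iff[OF assms(1)] c by (cases t) auto
    ultimately show ?thesis using no_saddle_new_crossing[OF assms(1) _ m'] by blast
  qed
qed

end


section \<open>State cycles of quasipositive modifications\<close>

lemma crossing_labels_append [simp]: "crossing_labels (xs @ ys) = crossing_labels xs @ crossing_labels ys"
  by (simp add: crossing_labels_def)

lemma crossing_labels_tangle [simp]: "crossing_labels (tangle p ls) = map fst ls"
proof (induction ls)
  case (Cons x ls)
  then show ?case by (cases x) (simp add: tangle_def crossing_labels_def)
qed (simp add: tangle_def crossing_labels_def)

theorem theorem6p4:
  fixes D D' :: diagram and \<alpha> :: estate and k p n :: nat and bs :: "block list"
    and f :: "chain \<Rightarrow> chain" and \<Psi> :: "chain set \<Rightarrow> chain set"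
  assumes "link_diagram D"
    and "state_cycle D \<alpha>" and "nontrivial D \<alpha>"
    and "quasipositive_modification D \<alpha> D' k p n bs"
    and "jacobsson_chain_map (take k D) p (level D k ! p) (drop k D) bs f"
    and "induced_on_homology D' D f \<Psi>"
  shows "\<exists>\<alpha>'. state_cycle D' \<alpha>' \<and>
    f (ket \<alpha>') \<in> {ket \<alpha>, scale (-1) (ket \<alpha>)} \<and>
    \<Psi> (hclass D' (ket \<alpha>')) \<in> {hclass D (ket \<alpha>), hclass D (scale (-1) (ket \<alpha>))} \<and>
    fst \<alpha>' \<inter> crossings D = fst \<alpha> \<and>
    (\<forall>(c, t, i) \<in> set (braid_word bs). (c \<in> fst \<alpha>') = (t = TauInv)) \<and>
    bij_betw (image (collapse k (length (braid_word bs)))) (loops D' (fst \<alpha>')) (loops D (fst \<alpha>)) \<and>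
    (\<forall>K \<in> loops D' (fst \<alpha>').
       snd \<alpha>' K = snd \<alpha> (image (collapse k (length (braid_word bs))) K))"
proof -
  obtain S m where \<alpha>: "\<alpha> = (S, m)" by (cases \<alpha>)
  define X where "X = take k D"
  define Y where "Y = drop k D"
  define w where "w = width D k"
  define ls where "ls = braid_word bs"
  have XY: "X @ Y = D" by (simp add: X_def Y_def)
  have par: "braid_parallel D \<alpha> k p n" and qp: "quasipositive n bs"
    and D': "D' = X @ tangle p ls @ Y" and labels: "distinct (crossing_labels D')"
    using assms(4) unfolding quasipositive_modification_def X_def Y_def ls_def by blast+
  have k: "k \<le> length D" "p + n \<le> w"
    using par by (simp_all add: braid_parallel_def w_def)
  have lenX: "length X = k" using k by (simp add: X_def)
  have "spans 0 (X @ Y) 0" using link_diagram_spans[OF assms(1)] by (simp add: XY)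
  then have spans: "spans 0 X w" "spans w Y 0"
    by (simp_all add: spans_append X_def w_def width_fold)
  have est: "S \<subseteq> crossings D" "dom m = loops D S"
    using assms(2) by (simp_all add: \<alpha> state_cycle_def estates_def)
  interpret parallel_arcs X Y p n w S m
  proof
    show "inj_on (\<lambda>j. loop_of (X @ Y) S (length X, j)) {p..<p + n}"
      using par by (simp add: braid_parallel_def \<alpha> lenX XY)
    show "m (loop_of (X @ Y) S (length X, j)) = Some Minus" if "j \<in> {p..<p + n}" for j
      using par that by (simp add: braid_parallel_def \<alpha> lenX XY)
  qed (use spans est k in \<open>simp_all only: XY\<close>)
  have "snd (snd x) + 1 < n" if "x \<in> set ls" for x
    using qp that by (auto simp: quasipositive_def ls_def)
  then have fresh: "fresh ls"
    using labels unfolding fresh_def by (auto simp: D' crossings_def)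
  let ?\<alpha>' = "(smoothing ls, marks ls)"
  have cyc: "state_cycle D' ?\<alpha>'"
    unfolding D' using fresh assms(2) by (intro state_cycle_braided) (simp_all only: XY \<alpha>)
  obtain s where s: "s \<in> {1, -1}" "f (ket ?\<alpha>') = scale s (ket \<alpha>)"
    using jacobsson_ket[of _ bs f] assms(5) fresh unfolding X_def Y_def ls_def \<alpha> by blast
  obtain q where q: "q \<in> {1, -1}"
    "\<And>z. z \<in> cycles D' \<Longrightarrow> \<Psi> (hclass D' z) = hclass D (scale q (f z))"
    using assms(6) unfolding induced_on_homology_def by blast
  have "ket ?\<alpha>' \<in> cycles D'"
    using cyc by (auto simp: cycles_def chains_def ket_def state_cycle_def)
  then have "\<Psi> (hclass D' (ket ?\<alpha>')) = hclass D (scale (q * s) (ket \<alpha>))"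
    using q(2) s(2) by simp
  moreover have "q * s = 1 \<or> q * s = -1" using q(1) s(1) by auto
  ultimately have \<Psi>: "\<Psi> (hclass D' (ket ?\<alpha>')) \<in> {hclass D (ket \<alpha>), hclass D (scale (-1) (ket \<alpha>))}"
    by (elim disjE) simp_all
  have sign: "f (ket ?\<alpha>') \<in> {ket \<alpha>, scale (-1) (ket \<alpha>)}"
    using s(1) unfolding s(2) by (elim insertE) simp_all
  show ?thesis
  proof (intro exI[of _ ?\<alpha>'] conjI)
    show "fst ?\<alpha>' \<inter> crossings D = fst \<alpha>" using smoothing_old[OF fresh] by (simp only: XY \<alpha> fst_conv)
    show "\<forall>(c, t, i) \<in> set (braid_word bs). (c \<in> fst ?\<alpha>') = (t = TauInv)"
      using smoothing_iff[OF fresh] by (auto simp: ls_def)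
    show "bij_betw (image (collapse k (length (braid_word bs)))) (loops D' (fst ?\<alpha>')) (loops D (fst \<alpha>))"
      using collapse_loops(1)[OF fresh] by (simp only: lenX XY \<alpha> fst_conv ls_def D')
    show "\<forall>K \<in> loops D' (fst ?\<alpha>').
        snd ?\<alpha>' K = snd \<alpha> (image (collapse k (length (braid_word bs))) K)"
      using collapse_loops(2)[OF fresh] by (simp add: lenX \<alpha> ls_def D')
  qed (rule cyc sign \<Psi>)+
qed

end
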